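(* Let $\mathcal X$ and $\mathcal Y$ be categories. The composite functor $\Upsilon\Gamma:\mathsf{Mor}(\mathcal X,\mathcal Y)\to\mathsf{Mor}(\mathcal X,\mathcal Y)$ is the identity functor on $\mathsf{Mor}(\mathcal X,\mathcal Y)$.
   Context: Composition of functors is juxtaposition; identities are denoted by the object/functor itself. Bialgebra functors. For monads $\mathbf A=(A,\mathsf m^A,\mathsf u^A)$ on $\mathcal X$ and $\mathbf B=(B,\mathsf m^B,\mathsf u^B)$ on $\mathcal Y$, an $\mathbf A$-$\mathbf B$ bialgebra functor $\mathbf T=(T,\lambda,\rho)$ is a functor $T:\mathcal Y\to\mathcal X$ with natural transformations $\lambda:AT\to T$, $\rho:TB\to T$ such that $\rho\circ T\mathsf m^B=\rho\circ\rho B$, $\rho\circ T\mathsf u^B=T$, $\lambda\circ\mathsf m^AT=\lambda\circ A\lambda$, $\lambda\circ\mathsf u^AT=T$, $\rho\circ\lambda B=\lambda\circ A\rho$. Category $\mathsf{Mor}(\mathcal X,\mathcal Y)$ of Morita contexts. Objects $\mathbb T=(\mathbf A,\mathbf B,\mathbf T,\widehat{\mathbf T},\mathrm{ev},\widehat{\mathrm{ev}})$: monads $\mathbf A$ on $\mathcal X$, $\mathbf B$ on $\mathcal Y$, an $\mathbf A$-$\mathbf B$ bialgebra functor $\mathbf T=(T,\lambda,\rho)$, a $\mathbf B$-$\mathbf A$ bialgebra functor $\widehat{\mathbf T}=(\widehat T:\mathcal X\to\mathcal Y,\ \hat\lambda:B\widehat T\to\widehat T,\ \hat\rho:\widehat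 TA\to\widehat T)$, and natural transformations $\mathrm{ev}:T\widehat T\to A$, $\widehat{\mathrm{ev}}:\widehat TT\to B$ with: $\mathrm{ev}\circ\lambda\widehat T=\mathsf m^A\circ A\,\mathrm{ev}$, $\mathrm{ev}\circ T\hat\rho=\mathsf m^A\circ\mathrm{ev}A$, $\widehat{\mathrm{ev}}\circ\hat\lambda T=\mathsf m^B\circ B\,\widehat{\mathrm{ev}}$, $\widehat{\mathrm{ev}}\circ\widehat T\rho=\mathsf m^B\circ\widehat{\mathrm{ev}}B$, $\rho\circ T\widehat{\mathrm{ev}}=\lambda\circ\mathrm{ev}T$, $\hat\lambda\circ\widehat{\mathrm{ev}}\widehat T=\hat\rho\circ\widehat T\mathrm{ev}$, $\widehat{\mathrm{ev}}\circ\widehat T\lambda=\widehat{\mathrm{ev}}\circ\hat\rho T$, $\mathrm{ev}\circ\rho\widehat T=\mathrm{ev}\circ T\hat\lambda$. Morphisms $\mathbb T\to\mathbb T'$ are quadruples $(\phi^1,\phi^2,\phi^3,\phi^4)$ with $\phi^1:\mathbf A\to\mathbf A'$, $\phi^2:\mathbf B\to\mathbf B'$ monad morphisms (natural transformations commuting with multiplications and units), and natural transformations $\phi^3:T\to T'$, $\phi^4:\widehat T\to\widehat T'$ such that $\phi^3\circ\rho=\rho'\circ T'\phi^2\circ\phi^3B$, $\phi^3\circ\lambda=\lambda'\circ\phi^1T'\circ A\phi^3$, $\phi^4\circ\hat\rho=\hat\rho'\circ\widehat T'\phi^1\circ\phi^4A$, $\phi^4\circ\hat\lambda=\hat\lambda'\circ\phi^2\widehat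 T'\circ B\phi^4$, $\phi^1\circ\mathrm{ev}=\mathrm{ev}'\circ\phi^3\phi^4$, $\phi^2\circ\widehat{\mathrm{ev}}=\widehat{\mathrm{ev}}'\circ\phi^4\phi^3$ (Godement products). Category $\mathsf{Adj}(\mathcal X,\mathcal Y)$ of double adjunctions. Objects $\mathfrak Z=(\mathcal Z,(L_A,R_A),(L_B,R_B))$: a category $\mathcal Z$ with adjunctions $(L_A:\mathcal X\to\mathcal Z,R_A:\mathcal Z\to\mathcal X)$, $(L_B:\mathcal Y\to\mathcal Z,R_B:\mathcal Z\to\mathcal Y)$ (left adjoint first), units $\eta^A,\eta^B$, counits $\varepsilon^A,\varepsilon^B$. A morphism $\mathfrak Z\to\mathfrak Z'$ is a functor $F:\mathcal Z'\to\mathcal Z$ (note the direction) with $R_AF=R'_A$, $R_BF=R'_B$. Functor $\Upsilon:\mathsf{Adj}(\mathcal X,\mathcal Y)\to\mathsf{Mor}(\mathcal X,\mathcal Y)$. $\Upsilon(\mathfrak Z)$ has monads $(R_AL_A,R_A\varepsilon^AL_A,\eta^A)$, $(R_BL_B,R_B\varepsilon^BL_B,\eta^B)$, bialgebra functors $(R_AL_B,R_A\varepsilon^AL_B,R_A\varepsilon^BL_B)$, $(R_BL_A,R_B\varepsilon^BL_A,R_B\varepsilon^AL_A)$ (left action, then right action), and $\mathrm{ev}=R_A\varepsilon^BL_A$, $\widehat{\mathrm{ev}}=R_B\varepsilon^AL_B$. For $F:\mathfrak Z\to\mathfrak Z'$ put $a=(\varepsilon^AFL'_A)\circ(L_A\eta'^A)$,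 $b=(\varepsilon^BFL'_B)\circ(L_B\eta'^B)$; then $\Upsilon(F)=(R_Aa,R_Bb,R_Ab,R_Ba)$. Eilenberg-Moore category $(\mathcal X,\mathcal Y)^{\mathbb T}$. Objects $((X,\rho^X),(Y,\rho^Y),v,w)$ with $(X,\rho^X)$ an $\mathbf A$-algebra, $(Y,\rho^Y)$ a $\mathbf B$-algebra, $v:TY\to X$, $w:\widehat TX\to Y$ with $v\circ\lambda Y=\rho^X\circ Av$, $w\circ\hat\lambda X=\rho^Y\circ Bw$, $v\circ Tw=\rho^X\circ\mathrm{ev}X$, $w\circ\widehat Tv=\rho^Y\circ\widehat{\mathrm{ev}}Y$, $w\circ\widehat T\rho^X=w\circ\hat\rho X$, $v\circ T\rho^Y=v\circ\rho Y$. Morphisms: pairs $(f,g)$ of an $\mathbf A$-algebra morphism $f:X\to X'$ and a $\mathbf B$-algebra morphism $g:Y\to Y'$ with $g\circ w=w'\circ\widehat Tf$, $f\circ v=v'\circ Tg$. Functor $\Gamma:\mathsf{Mor}(\mathcal X,\mathcal Y)\to\mathsf{Adj}(\mathcal X,\mathcal Y)$. $\Gamma(\mathbb T)=((\mathcal X,\mathcal Y)^{\mathbb T},(G_A,U_A),(G_B,U_B))$, where $U_A,U_B$ are the forgetful functors to $X$, resp. $Y$, and $G_AX=((AX,\mathsf m^AX),(\widehat TX,\hat\lambda X),\mathrm{ev}X,\hat\rho X)$, $G_Af=(Af,\widehat Tf)$, $G_BY=((TY,\lambda Y),(BY,\mathsf m^BY),\rho Y,\widehat{\mathrm{ev}}Y)$,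 $G_Bg=(Tg,Bg)$; the units are $\mathsf u^A$, $\mathsf u^B$ and the counits at $((X,\rho^X),(Y,\rho^Y),v,w)$ are $(\rho^X,w)$ and $(v,\rho^Y)$ respectively. For a morphism $\phi:\mathbb T\to\mathbb T'$, $\Gamma(\phi)$ is the functor $(\mathcal X,\mathcal Y)^{\mathbb T'}\to(\mathcal X,\mathcal Y)^{\mathbb T}$, $((X,\rho^X),(Y,\rho^Y),v,w)\mapsto((X,\rho^X\circ\phi^1X),(Y,\rho^Y\circ\phi^2Y),v\circ\phi^3Y,w\circ\phi^4X)$, identity on morphisms. *)

theory Defs
  imports Main "HOL-Library.FuncSet"
begin

record ('o, 'm) cat =
  Obj :: "'o set"
  Arr :: "'m set"
  Dom :: "'m \<Rightarrow> 'o"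
  Cod :: "'m \<Rightarrow> 'o"
  Ide :: "'o \<Rightarrow> 'm"
  Comp :: "'m \<Rightarrow> 'm \<Rightarrow> 'm"  (infixr \<open>\<cdot>\<index>\<close> 70)

definition hom :: "('o, 'm) cat \<Rightarrow> 'o \<Rightarrow> 'o \<Rightarrow> 'm set" where
  "hom C a b = {f \<in> Arr C. Dom C f = a \<and> Cod C f = b}"

locale category =
  fixes C :: "('o, 'm) cat" (structure)
  assumes Dom_Obj: "f \<in> Arr C \<Longrightarrow> Dom C f \<in> Obj C"
    and Cod_Obj: "f \<in> Arr C \<Longrightarrow> Cod C f \<in> Obj C"
    and Ide_hom: "a \<in> Obj C \<Longrightarrow> Ide C a \<in> hom C a a"
    and Comp_hom: "f \<in> hom C a b \<Longrightarrow> g \<in> hom C b c \<Longrightarrow> g \<cdot> f \<in> hom C a c"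
    and Comp_Ide_Dom: "f \<in> Arr C \<Longrightarrow> f \<cdot> Ide C (Dom C f) = f"
    and Comp_Ide_Cod: "f \<in> Arr C \<Longrightarrow> Ide C (Cod C f) \<cdot> f = f"
    and Comp_assoc: "f \<in> Arr C \<Longrightarrow> g \<in> Arr C \<Longrightarrow> h \<in> Arr C \<Longrightarrow>
      Dom C g = Cod C f \<Longrightarrow> Dom C h = Cod C g \<Longrightarrow> (h \<cdot> g) \<cdot> f = h \<cdot> (g \<cdot> f)"

text \<open>
  Object maps, arrow maps and families of components are required to be \<open>extensional\<close>,
  i.e. \<open>undefined\<close> off their domain. Hence HOL equality of functors and of natural
  transformations is equality on the objects and arrows of the source category.
\<close>

record ('o, 'm, 'p, 'n) ftor =
  Fo :: "'o \<Rightarrow> 'p"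
  Fa :: "'m \<Rightarrow> 'n"

locale is_functor = C: category C + D: category D
  for C :: "('o, 'm) cat" and D :: "('p, 'n) cat" and F :: "('o, 'm, 'p, 'n) ftor" +
  assumes Fo_ext: "Fo F \<in> Obj C \<rightarrow>\<^sub>E Obj D"
    and Fa_ext: "Fa F \<in> extensional (Arr C)"
    and Fa_hom: "f \<in> hom C a b \<Longrightarrow> Fa F f \<in> hom D (Fo F a) (Fo F b)"
    and Fa_Ide: "a \<in> Obj C \<Longrightarrow> Fa F (Ide C a) = Ide D (Fo F a)"
    and Fa_Comp: "f \<in> Arr C \<Longrightarrow> g \<in> Arr C \<Longrightarrow> Dom C g = Cod C f \<Longrightarrow>
      Fa F (g \<cdot>\<^bsub>C\<^esub> f) = Fa F g \<cdot>\<^bsub>D\<^esub> Fa F f"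

definition ftor_id :: "('o, 'm) cat \<Rightarrow> ('o, 'm, 'o, 'm) ftor" where
  "ftor_id C = \<lparr>Fo = (\<lambda>a\<in>Obj C. a), Fa = (\<lambda>f\<in>Arr C. f)\<rparr>"

text \<open>\<open>ftor_comp C G F\<close> is the composite \<open>GF\<close> of a functor \<open>F\<close> with source \<open>C\<close> and a functor \<open>G\<close>.\<close>

definition ftor_comp :: "('o, 'm) cat \<Rightarrow> ('p, 'n, 'q, 'r) ftor \<Rightarrow> ('o, 'm, 'p, 'n) ftor \<Rightarrow>
    ('o, 'm, 'q, 'r) ftor" where
  "ftor_comp C G F = \<lparr>Fo = (\<lambda>a\<in>Obj C. Fo G (Fo F a)), Fa = (\<lambda>f\<in>Arr C. Fa G (Fa F f))\<rparr>"

locale is_nat_trans = F: is_functor C D F + G: is_functor C D G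
  for C :: "('o, 'm) cat" and D :: "('p, 'n) cat"
    and F :: "('o, 'm, 'p, 'n) ftor" and G :: "('o, 'm, 'p, 'n) ftor" and t :: "'o \<Rightarrow> 'n" +
  assumes comp_ext: "t \<in> extensional (Obj C)"
    and comp_hom: "a \<in> Obj C \<Longrightarrow> t a \<in> hom D (Fo F a) (Fo G a)"
    and naturality: "f \<in> hom C a b \<Longrightarrow> t b \<cdot>\<^bsub>D\<^esub> Fa F f = Fa G f \<cdot>\<^bsub>D\<^esub> t a"

record ('o, 'm) monad =
  fn :: "('o, 'm, 'o, 'm) ftor"
  mul :: "'o \<Rightarrow> 'm"
  unit :: "'o \<Rightarrow> 'm"

locale is_monad = category C +
  mul: is_nat_trans C C "ftor_comp C (fn M) (fn M)" "fn M" "mul M" +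
  unit: is_nat_trans C C "ftor_id C" "fn M" "unit M"
  for C :: "('o, 'm) cat" and M :: "('o, 'm) monad" +
  assumes mul_assoc: "a \<in> Obj C \<Longrightarrow>
      mul M a \<cdot>\<^bsub>C\<^esub> Fa (fn M) (mul M a) = mul M a \<cdot>\<^bsub>C\<^esub> mul M (Fo (fn M) a)"
    and unit_left: "a \<in> Obj C \<Longrightarrow> mul M a \<cdot>\<^bsub>C\<^esub> unit M (Fo (fn M) a) = Ide C (Fo (fn M) a)"
    and unit_right: "a \<in> Obj C \<Longrightarrow> mul M a \<cdot>\<^bsub>C\<^esub> Fa (fn M) (unit M a) = Ide C (Fo (fn M) a)"

record ('xo, 'xm, 'yo, 'ym) bialg =
  bf :: "('yo, 'ym, 'xo, 'xm) ftor"
  lact :: "'yo \<Rightarrow> 'xm"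
  ract :: "'yo \<Rightarrow> 'xm"

locale is_bialg = A: is_monad \<X> A + B: is_monad \<Y> B +
  T: is_functor \<Y> \<X> "bf T" +
  lact: is_nat_trans \<Y> \<X> "ftor_comp \<Y> (fn A) (bf T)" "bf T" "lact T" +
  ract: is_nat_trans \<Y> \<X> "ftor_comp \<Y> (bf T) (fn B)" "bf T" "ract T"
  for \<X> :: "('xo, 'xm) cat" and \<Y> :: "('yo, 'ym) cat"
    and A :: "('xo, 'xm) monad" and B :: "('yo, 'ym) monad"
    and T :: "('xo, 'xm, 'yo, 'ym) bialg" +
  assumes ract_mul: "y \<in> Obj \<Y> \<Longrightarrow>
      ract T y \<cdot>\<^bsub>\<X>\<^esub> Fa (bf T) (mul B y) = ract T y \<cdot>\<^bsub>\<X>\<^esub> ract T (Fo (fn B) y)"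
    and ract_unit: "y \<in> Obj \<Y> \<Longrightarrow>
      ract T y \<cdot>\<^bsub>\<X>\<^esub> Fa (bf T) (unit B y) = Ide \<X> (Fo (bf T) y)"
    and lact_mul: "y \<in> Obj \<Y> \<Longrightarrow>
      lact T y \<cdot>\<^bsub>\<X>\<^esub> mul A (Fo (bf T) y) = lact T y \<cdot>\<^bsub>\<X>\<^esub> Fa (fn A) (lact T y)"
    and lact_unit: "y \<in> Obj \<Y> \<Longrightarrow>
      lact T y \<cdot>\<^bsub>\<X>\<^esub> unit A (Fo (bf T) y) = Ide \<X> (Fo (bf T) y)"
    and ract_lact: "y \<in> Obj \<Y> \<Longrightarrow>
      ract T y \<cdot>\<^bsub>\<X>\<^esub> lact T (Fo (fn B) y) = lact T y \<cdot>\<^bsub>\<X>\<^esub> Fa (fn A) (ract T y)"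

record ('xo, 'xm, 'zo, 'zm) adjunction =
  ladj :: "('xo, 'xm, 'zo, 'zm) ftor"
  radj :: "('zo, 'zm, 'xo, 'xm) ftor"
  eta :: "'xo \<Rightarrow> 'xm"
  eps :: "'zo \<Rightarrow> 'zm"

locale is_adjunction = L: is_functor \<X> \<Z> "ladj H" + R: is_functor \<Z> \<X> "radj H" +
  eta: is_nat_trans \<X> \<X> "ftor_id \<X>" "ftor_comp \<X> (radj H) (ladj H)" "eta H" +
  eps: is_nat_trans \<Z> \<Z> "ftor_comp \<Z> (ladj H) (radj H)" "ftor_id \<Z>" "eps H"
  for \<X> :: "('xo, 'xm) cat" and \<Z> :: "('zo, 'zm) cat"
    and H :: "('xo, 'xm, 'zo, 'zm) adjunction" +
  assumes triangle_L: "x \<in> Obj \<X> \<Longrightarrow>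
      eps H (Fo (ladj H) x) \<cdot>\<^bsub>\<Z>\<^esub> Fa (ladj H) (eta H x) = Ide \<Z> (Fo (ladj H) x)"
    and triangle_R: "z \<in> Obj \<Z> \<Longrightarrow>
      Fa (radj H) (eps H z) \<cdot>\<^bsub>\<X>\<^esub> eta H (Fo (radj H) z) = Ide \<X> (Fo (radj H) z)"

text \<open>
  Arrows of the categories constructed below carry their source and target: the underlying
  data do not determine them.
\<close>

record ('o, 'd) arrow =
  Src :: 'o
  Tgt :: 'o
  Map :: 'd

text \<open>The fields \<open>bim\<close> and \<open>bimh\<close> are \<open>T\<close> and \<open>T\<close>-hat, \<open>evh\<close> is \<open>ev\<close>-hat.\<close>

record ('xo, 'xm, 'yo, 'ym) morita =
  mnA :: "('xo, 'xm) monad"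
  mnB :: "('yo, 'ym) monad"
  bim :: "('xo, 'xm, 'yo, 'ym) bialg"
  bimh :: "('yo, 'ym, 'xo, 'xm) bialg"
  ev :: "'xo \<Rightarrow> 'xm"
  evh :: "'yo \<Rightarrow> 'ym"

abbreviation "fA T \<equiv> fn (mnA T)"
abbreviation "fB T \<equiv> fn (mnB T)"
abbreviation "fT T \<equiv> bf (bim T)"
abbreviation "fTh T \<equiv> bf (bimh T)"
abbreviation "lam T \<equiv> lact (bim T)"
abbreviation "rho T \<equiv> ract (bim T)"
abbreviation "lamh T \<equiv> lact (bimh T)"
abbreviation "rhoh T \<equiv> ract (bimh T)"

locale is_morita =
  T: is_bialg \<X> \<Y> "mnA T" "mnB T" "bim T" +
  Th: is_bialg \<Y> \<X> "mnB T" "mnA T" "bimh T" +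
  ev: is_nat_trans \<X> \<X> "ftor_comp \<X> (fT T) (fTh T)" "fA T" "ev T" +
  evh: is_nat_trans \<Y> \<Y> "ftor_comp \<Y> (fTh T) (fT T)" "fB T" "evh T"
  for \<X> :: "('xo, 'xm) cat" and \<Y> :: "('yo, 'ym) cat" and T :: "('xo, 'xm, 'yo, 'ym) morita" +
  assumes ev_lam: "x \<in> Obj \<X> \<Longrightarrow>
      ev T x \<cdot>\<^bsub>\<X>\<^esub> lam T (Fo (fTh T) x) = mul (mnA T) x \<cdot>\<^bsub>\<X>\<^esub> Fa (fA T) (ev T x)"
    and ev_rhoh: "x \<in> Obj \<X> \<Longrightarrow>
      ev T x \<cdot>\<^bsub>\<X>\<^esub> Fa (fT T) (rhoh T x) = mul (mnA T) x \<cdot>\<^bsub>\<X>\<^esub> ev T (Fo (fA T) x)"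
    and evh_lamh: "y \<in> Obj \<Y> \<Longrightarrow>
      evh T y \<cdot>\<^bsub>\<Y>\<^esub> lamh T (Fo (fT T) y) = mul (mnB T) y \<cdot>\<^bsub>\<Y>\<^esub> Fa (fB T) (evh T y)"
    and evh_rho: "y \<in> Obj \<Y> \<Longrightarrow>
      evh T y \<cdot>\<^bsub>\<Y>\<^esub> Fa (fTh T) (rho T y) = mul (mnB T) y \<cdot>\<^bsub>\<Y>\<^esub> evh T (Fo (fB T) y)"
    and rho_evh: "y \<in> Obj \<Y> \<Longrightarrow>
      rho T y \<cdot>\<^bsub>\<X>\<^esub> Fa (fT T) (evh T y) = lam T y \<cdot>\<^bsub>\<X>\<^esub> ev T (Fo (fT T) y)"
    and lamh_evh: "x \<in> Obj \<X> \<Longrightarrow>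
      lamh T x \<cdot>\<^bsub>\<Y>\<^esub> evh T (Fo (fTh T) x) = rhoh T x \<cdot>\<^bsub>\<Y>\<^esub> Fa (fTh T) (ev T x)"
    and evh_lam: "y \<in> Obj \<Y> \<Longrightarrow>
      evh T y \<cdot>\<^bsub>\<Y>\<^esub> Fa (fTh T) (lam T y) = evh T y \<cdot>\<^bsub>\<Y>\<^esub> rhoh T (Fo (fT T) y)"
    and ev_rho: "x \<in> Obj \<X> \<Longrightarrow>
      ev T x \<cdot>\<^bsub>\<X>\<^esub> rho T (Fo (fTh T) x) = ev T x \<cdot>\<^bsub>\<X>\<^esub> Fa (fT T) (lamh T x)"

text \<open>
  The Godement product of \<open>s : G \<rightarrow> G'\<close> and \<open>t : F \<rightarrow> F'\<close> is taken in the form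
  \<open>a \<mapsto> s (F' a) \<circ> G (t a) : GF \<rightarrow> G'F'\<close>.
\<close>

locale is_monad_mor = M: is_monad C M + M': is_monad C M' + is_nat_trans C C "fn M" "fn M'" p
  for C :: "('o, 'm) cat" and M :: "('o, 'm) monad" and M' :: "('o, 'm) monad"
    and p :: "'o \<Rightarrow> 'm" +
  assumes mor_mul: "a \<in> Obj C \<Longrightarrow>
      p a \<cdot>\<^bsub>C\<^esub> mul M a = mul M' a \<cdot>\<^bsub>C\<^esub> (p (Fo (fn M') a) \<cdot>\<^bsub>C\<^esub> Fa (fn M) (p a))"
    and mor_unit: "a \<in> Obj C \<Longrightarrow> p a \<cdot>\<^bsub>C\<^esub> unit M a = unit M' a"

record ('xo, 'xm, 'yo, 'ym) morita_map =
  phi1 :: "'xo \<Rightarrow> 'xm"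
  phi2 :: "'yo \<Rightarrow> 'ym"
  phi3 :: "'yo \<Rightarrow> 'xm"
  phi4 :: "'xo \<Rightarrow> 'ym"

locale is_morita_mor =
  S: is_morita \<X> \<Y> T + S': is_morita \<X> \<Y> T' +
  p1: is_monad_mor \<X> "mnA T" "mnA T'" "phi1 p" +
  p2: is_monad_mor \<Y> "mnB T" "mnB T'" "phi2 p" +
  p3: is_nat_trans \<Y> \<X> "fT T" "fT T'" "phi3 p" +
  p4: is_nat_trans \<X> \<Y> "fTh T" "fTh T'" "phi4 p"
  for \<X> :: "('xo, 'xm) cat" and \<Y> :: "('yo, 'ym) cat"
    and T :: "('xo, 'xm, 'yo, 'ym) morita" and T' :: "('xo, 'xm, 'yo, 'ym) morita"
    and p :: "('xo, 'xm, 'yo, 'ym) morita_map" +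
  assumes phi3_rho: "y \<in> Obj \<Y> \<Longrightarrow> phi3 p y \<cdot>\<^bsub>\<X>\<^esub> rho T y =
      rho T' y \<cdot>\<^bsub>\<X>\<^esub> (Fa (fT T') (phi2 p y) \<cdot>\<^bsub>\<X>\<^esub> phi3 p (Fo (fB T) y))"
    and phi3_lam: "y \<in> Obj \<Y> \<Longrightarrow> phi3 p y \<cdot>\<^bsub>\<X>\<^esub> lam T y =
      lam T' y \<cdot>\<^bsub>\<X>\<^esub> (phi1 p (Fo (fT T') y) \<cdot>\<^bsub>\<X>\<^esub> Fa (fA T) (phi3 p y))"
    and phi4_rhoh: "x \<in> Obj \<X> \<Longrightarrow> phi4 p x \<cdot>\<^bsub>\<Y>\<^esub> rhoh T x =
      rhoh T' x \<cdot>\<^bsub>\<Y>\<^esub> (Fa (fTh T') (phi1 p x) \<cdot>\<^bsub>\<Y>\<^esub> phi4 p (Fo (fA T) x))"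
    and phi4_lamh: "x \<in> Obj \<X> \<Longrightarrow> phi4 p x \<cdot>\<^bsub>\<Y>\<^esub> lamh T x =
      lamh T' x \<cdot>\<^bsub>\<Y>\<^esub> (phi2 p (Fo (fTh T') x) \<cdot>\<^bsub>\<Y>\<^esub> Fa (fB T) (phi4 p x))"
    and phi1_ev: "x \<in> Obj \<X> \<Longrightarrow> phi1 p x \<cdot>\<^bsub>\<X>\<^esub> ev T x =
      ev T' x \<cdot>\<^bsub>\<X>\<^esub> (phi3 p (Fo (fTh T') x) \<cdot>\<^bsub>\<X>\<^esub> Fa (fT T) (phi4 p x))"
    and phi2_evh: "y \<in> Obj \<Y> \<Longrightarrow> phi2 p y \<cdot>\<^bsub>\<Y>\<^esub> evh T y =
      evh T' y \<cdot>\<^bsub>\<Y>\<^esub> (phi4 p (Fo (fT T') y) \<cdot>\<^bsub>\<Y>\<^esub> Fa (fTh T) (phi3 p y))"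

type_synonym ('xo, 'xm, 'yo, 'ym) morita_arr =
  "(('xo, 'xm, 'yo, 'ym) morita, ('xo, 'xm, 'yo, 'ym) morita_map) arrow"

definition Mor :: "('xo, 'xm) cat \<Rightarrow> ('yo, 'ym) cat \<Rightarrow>
    (('xo, 'xm, 'yo, 'ym) morita, ('xo, 'xm, 'yo, 'ym) morita_arr) cat" where
  "Mor \<X> \<Y> = \<lparr>
     Obj = {T. is_morita \<X> \<Y> T},
     Arr = {p. is_morita_mor \<X> \<Y> (Src p) (Tgt p) (Map p)},
     Dom = Src,
     Cod = Tgt,
     Ide = (\<lambda>T. \<lparr>Src = T, Tgt = T, Map = \<lparr>
       phi1 = (\<lambda>x\<in>Obj \<X>. Ide \<X> (Fo (fA T) x)),
       phi2 = (\<lambda>y\<in>Obj \<Y>. Ide \<Y> (Fo (fB T) y)),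
       phi3 = (\<lambda>y\<in>Obj \<Y>. Ide \<X> (Fo (fT T) y)),
       phi4 = (\<lambda>x\<in>Obj \<X>. Ide \<Y> (Fo (fTh T) x))\<rparr>\<rparr>),
     Comp = (\<lambda>q p. \<lparr>Src = Src p, Tgt = Tgt q, Map = \<lparr>
       phi1 = (\<lambda>x\<in>Obj \<X>. phi1 (Map q) x \<cdot>\<^bsub>\<X>\<^esub> phi1 (Map p) x),
       phi2 = (\<lambda>y\<in>Obj \<Y>. phi2 (Map q) y \<cdot>\<^bsub>\<Y>\<^esub> phi2 (Map p) y),
       phi3 = (\<lambda>y\<in>Obj \<Y>. phi3 (Map q) y \<cdot>\<^bsub>\<X>\<^esub> phi3 (Map p) y),
       phi4 = (\<lambda>x\<in>Obj \<X>. phi4 (Map q) x \<cdot>\<^bsub>\<Y>\<^esub> phi4 (Map p) x)\<rparr>\<rparr>)\<rparr>"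

record ('xo, 'xm, 'yo, 'ym, 'zo, 'zm) dadj =
  apex :: "('zo, 'zm) cat"
  adjA :: "('xo, 'xm, 'zo, 'zm) adjunction"
  adjB :: "('yo, 'ym, 'zo, 'zm) adjunction"

abbreviation "LA Z \<equiv> ladj (adjA Z)"
abbreviation "RA Z \<equiv> radj (adjA Z)"
abbreviation "LB Z \<equiv> ladj (adjB Z)"
abbreviation "RB Z \<equiv> radj (adjB Z)"

locale is_dadj = A: is_adjunction \<X> "apex Z" "adjA Z" + B: is_adjunction \<Y> "apex Z" "adjB Z"
  for \<X> :: "('xo, 'xm) cat" and \<Y> :: "('yo, 'ym) cat"
    and Z :: "('xo, 'xm, 'yo, 'ym, 'zo, 'zm) dadj"

locale is_dadj_mor = S: is_dadj \<X> \<Y> Z + S': is_dadj \<X> \<Y> Z' +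
  F: is_functor "apex Z'" "apex Z" F
  for \<X> :: "('xo, 'xm) cat" and \<Y> :: "('yo, 'ym) cat"
    and Z :: "('xo, 'xm, 'yo, 'ym, 'zo, 'zm) dadj"
    and Z' :: "('xo, 'xm, 'yo, 'ym, 'zo, 'zm) dadj"
    and F :: "('zo, 'zm, 'zo, 'zm) ftor" +
  assumes RA_comp: "ftor_comp (apex Z') (RA Z) F = RA Z'"
    and RB_comp: "ftor_comp (apex Z') (RB Z) F = RB Z'"

text \<open>
  The apex category ranges over the categories on a fixed pair of types \<open>'zo\<close>, \<open>'zm\<close>. An arrow
  \<open>Z \<rightarrow> Z'\<close> of \<open>Adj\<close> is a functor from the apex of \<open>Z'\<close> to the apex of \<open>Z\<close>.
\<close>

type_synonym ('xo, 'xm, 'yo, 'ym, 'zo, 'zm) dadj_arr =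
  "(('xo, 'xm, 'yo, 'ym, 'zo, 'zm) dadj, ('zo, 'zm, 'zo, 'zm) ftor) arrow"

definition Adj :: "('xo, 'xm) cat \<Rightarrow> ('yo, 'ym) cat \<Rightarrow>
    (('xo, 'xm, 'yo, 'ym, 'zo, 'zm) dadj, ('xo, 'xm, 'yo, 'ym, 'zo, 'zm) dadj_arr) cat" where
  "Adj \<X> \<Y> = \<lparr>
     Obj = {Z. is_dadj \<X> \<Y> Z},
     Arr = {F. is_dadj_mor \<X> \<Y> (Src F) (Tgt F) (Map F)},
     Dom = Src,
     Cod = Tgt,
     Ide = (\<lambda>Z. \<lparr>Src = Z, Tgt = Z, Map = ftor_id (apex Z)\<rparr>),
     Comp = (\<lambda>G F. \<lparr>Src = Src F, Tgt = Tgt G, Map = ftor_comp (apex (Tgt G)) (Map F) (Map G)\<rparr>)\<rparr>"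

definition Upsilon_obj :: "('xo, 'xm) cat \<Rightarrow> ('yo, 'ym) cat \<Rightarrow>
    ('xo, 'xm, 'yo, 'ym, 'zo, 'zm) dadj \<Rightarrow> ('xo, 'xm, 'yo, 'ym) morita" where
  "Upsilon_obj \<X> \<Y> Z = \<lparr>
     mnA = \<lparr>fn = ftor_comp \<X> (RA Z) (LA Z),
            mul = (\<lambda>x\<in>Obj \<X>. Fa (RA Z) (eps (adjA Z) (Fo (LA Z) x))),
            unit = eta (adjA Z)\<rparr>,
     mnB = \<lparr>fn = ftor_comp \<Y> (RB Z) (LB Z),
            mul = (\<lambda>y\<in>Obj \<Y>. Fa (RB Z) (eps (adjB Z) (Fo (LB Z) y))),
            unit = eta (adjB Z)\<rparr>,
     bim = \<lparr>bf = ftor_comp \<Y> (RA Z) (LB Z),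
            lact = (\<lambda>y\<in>Obj \<Y>. Fa (RA Z) (eps (adjA Z) (Fo (LB Z) y))),
            ract = (\<lambda>y\<in>Obj \<Y>. Fa (RA Z) (eps (adjB Z) (Fo (LB Z) y)))\<rparr>,
     bimh = \<lparr>bf = ftor_comp \<X> (RB Z) (LA Z),
             lact = (\<lambda>x\<in>Obj \<X>. Fa (RB Z) (eps (adjB Z) (Fo (LA Z) x))),
             ract = (\<lambda>x\<in>Obj \<X>. Fa (RB Z) (eps (adjA Z) (Fo (LA Z) x)))\<rparr>,
     ev = (\<lambda>x\<in>Obj \<X>. Fa (RA Z) (eps (adjB Z) (Fo (LA Z) x))),
     evh = (\<lambda>y\<in>Obj \<Y>. Fa (RB Z) (eps (adjA Z) (Fo (LB Z) y)))\<rparr>"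

text \<open>
  For adjunctions \<open>H\<close>, \<open>H'\<close> between a common category and \<open>D\<close>, \<open>D'\<close>, and \<open>F : D' \<rightarrow> D\<close> with
  \<open>R F = R'\<close>, this is the component at \<open>x\<close> of \<open>(\<epsilon> F L') \<circ> (L \<eta>') : L \<rightarrow> F L'\<close>.
\<close>

definition mate :: "('zo, 'zm) cat \<Rightarrow> ('xo, 'xm, 'zo, 'zm) adjunction \<Rightarrow>
    ('xo, 'xm, 'zo, 'zm) adjunction \<Rightarrow> ('zo, 'zm, 'zo, 'zm) ftor \<Rightarrow> 'xo \<Rightarrow> 'zm" where
  "mate D H H' F x = eps H (Fo F (Fo (ladj H') x)) \<cdot>\<^bsub>D\<^esub> Fa (ladj H) (eta H' x)"

definition Upsilon_map :: "('xo, 'xm) cat \<Rightarrow> ('yo, 'ym) cat \<Rightarrow>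
    ('xo, 'xm, 'yo, 'ym, 'zo, 'zm) dadj_arr \<Rightarrow> ('xo, 'xm, 'yo, 'ym) morita_map" where
  "Upsilon_map \<X> \<Y> F =
    (let Z = Src F; Z' = Tgt F;
         a = mate (apex Z) (adjA Z) (adjA Z') (Map F);
         b = mate (apex Z) (adjB Z) (adjB Z') (Map F)
     in \<lparr>phi1 = (\<lambda>x\<in>Obj \<X>. Fa (RA Z) (a x)),
         phi2 = (\<lambda>y\<in>Obj \<Y>. Fa (RB Z) (b y)),
         phi3 = (\<lambda>y\<in>Obj \<Y>. Fa (RA Z) (b y)),
         phi4 = (\<lambda>x\<in>Obj \<X>. Fa (RB Z) (a x))\<rparr>)"

definition Upsilon :: "('xo, 'xm) cat \<Rightarrow> ('yo, 'ym) cat \<Rightarrow>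
    (('xo, 'xm, 'yo, 'ym, 'zo, 'zm) dadj, ('xo, 'xm, 'yo, 'ym, 'zo, 'zm) dadj_arr,
     ('xo, 'xm, 'yo, 'ym) morita, ('xo, 'xm, 'yo, 'ym) morita_arr) ftor" where
  "Upsilon \<X> \<Y> = \<lparr>
     Fo = (\<lambda>Z\<in>Obj (Adj \<X> \<Y>). Upsilon_obj \<X> \<Y> Z),
     Fa = (\<lambda>F\<in>Arr (Adj \<X> \<Y>). \<lparr>Src = Upsilon_obj \<X> \<Y> (Src F), Tgt = Upsilon_obj \<X> \<Y> (Tgt F),
                              Map = Upsilon_map \<X> \<Y> F\<rparr>)\<rparr>"

definition is_algebra :: "('o, 'm) cat \<Rightarrow> ('o, 'm) monad \<Rightarrow> 'o \<Rightarrow> 'm \<Rightarrow> bool" where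
  "is_algebra C M a r \<longleftrightarrow> a \<in> Obj C \<and> r \<in> hom C (Fo (fn M) a) a \<and>
     r \<cdot>\<^bsub>C\<^esub> mul M a = r \<cdot>\<^bsub>C\<^esub> Fa (fn M) r \<and> r \<cdot>\<^bsub>C\<^esub> unit M a = Ide C a"

definition is_algebra_mor ::
    "('o, 'm) cat \<Rightarrow> ('o, 'm) monad \<Rightarrow> 'o \<Rightarrow> 'm \<Rightarrow> 'o \<Rightarrow> 'm \<Rightarrow> 'm \<Rightarrow> bool" where
  "is_algebra_mor C M a r a' r' f \<longleftrightarrow> f \<in> hom C a a' \<and> f \<cdot>\<^bsub>C\<^esub> r = r' \<cdot>\<^bsub>C\<^esub> Fa (fn M) f"

record ('xo, 'xm, 'yo, 'ym) em_obj =
  emX :: 'xo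
  actX :: 'xm
  emY :: 'yo
  actY :: 'ym
  emv :: 'xm
  emw :: 'ym

definition is_em_obj :: "('xo, 'xm) cat \<Rightarrow> ('yo, 'ym) cat \<Rightarrow> ('xo, 'xm, 'yo, 'ym) morita \<Rightarrow>
    ('xo, 'xm, 'yo, 'ym) em_obj \<Rightarrow> bool" where
  "is_em_obj \<X> \<Y> T E \<longleftrightarrow>
     is_algebra \<X> (mnA T) (emX E) (actX E) \<and>
     is_algebra \<Y> (mnB T) (emY E) (actY E) \<and>
     emv E \<in> hom \<X> (Fo (fT T) (emY E)) (emX E) \<and>
     emw E \<in> hom \<Y> (Fo (fTh T) (emX E)) (emY E) \<and>
     emv E \<cdot>\<^bsub>\<X>\<^esub> lam T (emY E) = actX E \<cdot>\<^bsub>\<X>\<^esub> Fa (fA T) (emv E) \<and>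
     emw E \<cdot>\<^bsub>\<Y>\<^esub> lamh T (emX E) = actY E \<cdot>\<^bsub>\<Y>\<^esub> Fa (fB T) (emw E) \<and>
     emv E \<cdot>\<^bsub>\<X>\<^esub> Fa (fT T) (emw E) = actX E \<cdot>\<^bsub>\<X>\<^esub> ev T (emX E) \<and>
     emw E \<cdot>\<^bsub>\<Y>\<^esub> Fa (fTh T) (emv E) = actY E \<cdot>\<^bsub>\<Y>\<^esub> evh T (emY E) \<and>
     emw E \<cdot>\<^bsub>\<Y>\<^esub> Fa (fTh T) (actX E) = emw E \<cdot>\<^bsub>\<Y>\<^esub> rhoh T (emX E) \<and>
     emv E \<cdot>\<^bsub>\<X>\<^esub> Fa (fT T) (actY E) = emv E \<cdot>\<^bsub>\<X>\<^esub> rho T (emY E)"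

definition is_em_mor :: "('xo, 'xm) cat \<Rightarrow> ('yo, 'ym) cat \<Rightarrow> ('xo, 'xm, 'yo, 'ym) morita \<Rightarrow>
    ('xo, 'xm, 'yo, 'ym) em_obj \<Rightarrow> ('xo, 'xm, 'yo, 'ym) em_obj \<Rightarrow> 'xm \<times> 'ym \<Rightarrow> bool" where
  "is_em_mor \<X> \<Y> T E E' h \<longleftrightarrow>
     is_algebra_mor \<X> (mnA T) (emX E) (actX E) (emX E') (actX E') (fst h) \<and>
     is_algebra_mor \<Y> (mnB T) (emY E) (actY E) (emY E') (actY E') (snd h) \<and>
     snd h \<cdot>\<^bsub>\<Y>\<^esub> emw E = emw E' \<cdot>\<^bsub>\<Y>\<^esub> Fa (fTh T) (fst h) \<and>
     fst h \<cdot>\<^bsub>\<X>\<^esub> emv E = emv E' \<cdot>\<^bsub>\<X>\<^esub> Fa (fT T) (snd h)"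

type_synonym ('xo, 'xm, 'yo, 'ym) em_arr = "(('xo, 'xm, 'yo, 'ym) em_obj, 'xm \<times> 'ym) arrow"

definition EM :: "('xo, 'xm) cat \<Rightarrow> ('yo, 'ym) cat \<Rightarrow> ('xo, 'xm, 'yo, 'ym) morita \<Rightarrow>
    (('xo, 'xm, 'yo, 'ym) em_obj, ('xo, 'xm, 'yo, 'ym) em_arr) cat" where
  "EM \<X> \<Y> T = \<lparr>
     Obj = {E. is_em_obj \<X> \<Y> T E},
     Arr = {h. is_em_obj \<X> \<Y> T (Src h) \<and> is_em_obj \<X> \<Y> T (Tgt h) \<and>
               is_em_mor \<X> \<Y> T (Src h) (Tgt h) (Map h)},
     Dom = Src,
     Cod = Tgt,
     Ide = (\<lambda>E. \<lparr>Src = E, Tgt = E, Map = (Ide \<X> (emX E), Ide \<Y> (emY E))\<rparr>),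
     Comp = (\<lambda>k h. \<lparr>Src = Src h, Tgt = Tgt k,
                    Map = (fst (Map k) \<cdot>\<^bsub>\<X>\<^esub> fst (Map h), snd (Map k) \<cdot>\<^bsub>\<Y>\<^esub> snd (Map h))\<rparr>)\<rparr>"

definition GA_obj :: "('xo, 'xm, 'yo, 'ym) morita \<Rightarrow> 'xo \<Rightarrow> ('xo, 'xm, 'yo, 'ym) em_obj" where
  "GA_obj T x = \<lparr>emX = Fo (fA T) x, actX = mul (mnA T) x,
                 emY = Fo (fTh T) x, actY = lamh T x, emv = ev T x, emw = rhoh T x\<rparr>"

definition GB_obj :: "('xo, 'xm, 'yo, 'ym) morita \<Rightarrow> 'yo \<Rightarrow> ('xo, 'xm, 'yo, 'ym) em_obj" where
  "GB_obj T y = \<lparr>emX = Fo (fT T) y, actX = lam T y,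
                 emY = Fo (fB T) y, actY = mul (mnB T) y, emv = rho T y, emw = evh T y\<rparr>"

definition em_adjA :: "('xo, 'xm) cat \<Rightarrow> ('yo, 'ym) cat \<Rightarrow> ('xo, 'xm, 'yo, 'ym) morita \<Rightarrow>
    ('xo, 'xm, ('xo, 'xm, 'yo, 'ym) em_obj, ('xo, 'xm, 'yo, 'ym) em_arr) adjunction" where
  "em_adjA \<X> \<Y> T = \<lparr>
     ladj = \<lparr>Fo = (\<lambda>x\<in>Obj \<X>. GA_obj T x),
             Fa = (\<lambda>f\<in>Arr \<X>. \<lparr>Src = GA_obj T (Dom \<X> f), Tgt = GA_obj T (Cod \<X> f),
                              Map = (Fa (fA T) f, Fa (fTh T) f)\<rparr>)\<rparr>,
     radj = \<lparr>Fo = (\<lambda>E\<in>Obj (EM \<X> \<Y> T). emX E), Fa = (\<lambda>h\<in>Arr (EM \<X> \<Y> T). fst (Map h))\<rparr>,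
     eta = unit (mnA T),
     eps = (\<lambda>E\<in>Obj (EM \<X> \<Y> T). \<lparr>Src = GA_obj T (emX E), Tgt = E, Map = (actX E, emw E)\<rparr>)\<rparr>"

definition em_adjB :: "('xo, 'xm) cat \<Rightarrow> ('yo, 'ym) cat \<Rightarrow> ('xo, 'xm, 'yo, 'ym) morita \<Rightarrow>
    ('yo, 'ym, ('xo, 'xm, 'yo, 'ym) em_obj, ('xo, 'xm, 'yo, 'ym) em_arr) adjunction" where
  "em_adjB \<X> \<Y> T = \<lparr>
     ladj = \<lparr>Fo = (\<lambda>y\<in>Obj \<Y>. GB_obj T y),
             Fa = (\<lambda>g\<in>Arr \<Y>. \<lparr>Src = GB_obj T (Dom \<Y> g), Tgt = GB_obj T (Cod \<Y> g),
                              Map = (Fa (fT T) g, Fa (fB T) g)\<rparr>)\<rparr>,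
     radj = \<lparr>Fo = (\<lambda>E\<in>Obj (EM \<X> \<Y> T). emY E), Fa = (\<lambda>h\<in>Arr (EM \<X> \<Y> T). snd (Map h))\<rparr>,
     eta = unit (mnB T),
     eps = (\<lambda>E\<in>Obj (EM \<X> \<Y> T). \<lparr>Src = GB_obj T (emY E), Tgt = E, Map = (emv E, actY E)\<rparr>)\<rparr>"

definition Gamma_obj :: "('xo, 'xm) cat \<Rightarrow> ('yo, 'ym) cat \<Rightarrow> ('xo, 'xm, 'yo, 'ym) morita \<Rightarrow>
    ('xo, 'xm, 'yo, 'ym, ('xo, 'xm, 'yo, 'ym) em_obj, ('xo, 'xm, 'yo, 'ym) em_arr) dadj" where
  "Gamma_obj \<X> \<Y> T =
     \<lparr>apex = EM \<X> \<Y> T, adjA = em_adjA \<X> \<Y> T, adjB = em_adjB \<X> \<Y> T\<rparr>"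

definition em_pull_obj :: "('xo, 'xm) cat \<Rightarrow> ('yo, 'ym) cat \<Rightarrow> ('xo, 'xm, 'yo, 'ym) morita_map \<Rightarrow>
    ('xo, 'xm, 'yo, 'ym) em_obj \<Rightarrow> ('xo, 'xm, 'yo, 'ym) em_obj" where
  "em_pull_obj \<X> \<Y> p E = \<lparr>
     emX = emX E, actX = actX E \<cdot>\<^bsub>\<X>\<^esub> phi1 p (emX E),
     emY = emY E, actY = actY E \<cdot>\<^bsub>\<Y>\<^esub> phi2 p (emY E),
     emv = emv E \<cdot>\<^bsub>\<X>\<^esub> phi3 p (emY E), emw = emw E \<cdot>\<^bsub>\<Y>\<^esub> phi4 p (emX E)\<rparr>"

definition em_pull :: "('xo, 'xm) cat \<Rightarrow> ('yo, 'ym) cat \<Rightarrow> ('xo, 'xm, 'yo, 'ym) morita_arr \<Rightarrow>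
    (('xo, 'xm, 'yo, 'ym) em_obj, ('xo, 'xm, 'yo, 'ym) em_arr,
     ('xo, 'xm, 'yo, 'ym) em_obj, ('xo, 'xm, 'yo, 'ym) em_arr) ftor" where
  "em_pull \<X> \<Y> p = \<lparr>
     Fo = (\<lambda>E\<in>Obj (EM \<X> \<Y> (Tgt p)). em_pull_obj \<X> \<Y> (Map p) E),
     Fa = (\<lambda>h\<in>Arr (EM \<X> \<Y> (Tgt p)). \<lparr>Src = em_pull_obj \<X> \<Y> (Map p) (Src h),
                                     Tgt = em_pull_obj \<X> \<Y> (Map p) (Tgt h), Map = Map h\<rparr>)\<rparr>"

definition Gamma :: "('xo, 'xm) cat \<Rightarrow> ('yo, 'ym) cat \<Rightarrow>
    (('xo, 'xm, 'yo, 'ym) morita, ('xo, 'xm, 'yo, 'ym) morita_arr,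
     ('xo, 'xm, 'yo, 'ym, ('xo, 'xm, 'yo, 'ym) em_obj, ('xo, 'xm, 'yo, 'ym) em_arr) dadj,
     ('xo, 'xm, 'yo, 'ym, ('xo, 'xm, 'yo, 'ym) em_obj, ('xo, 'xm, 'yo, 'ym) em_arr) dadj_arr)
    ftor" where
  "Gamma \<X> \<Y> = \<lparr>
     Fo = (\<lambda>T\<in>Obj (Mor \<X> \<Y>). Gamma_obj \<X> \<Y> T),
     Fa = (\<lambda>p\<in>Arr (Mor \<X> \<Y>). \<lparr>Src = Gamma_obj \<X> \<Y> (Src p), Tgt = Gamma_obj \<X> \<Y> (Tgt p),
                              Map = em_pull \<X> \<Y> p\<rparr>)\<rparr>"

end

theory Submission
  imports Defs
begin

text \<open>
  Write \<open>G\<^sub>A, G\<^sub>B\<close> for the left adjoints and \<open>U\<^sub>A, U\<^sub>B\<close> for the forgetful functors of the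
  Eilenberg-Moore category of a Morita context \<open>T\<close>. On objects the composite is the identity because
  nothing is lost in passing to the Eilenberg-Moore category. A forgetful functor after a left adjoint
  gives back one of the four underlying functors of \<open>T\<close>. The counits at an object
  \<open>((X, r), (Y, s), v, w)\<close> are \<open>(r, w)\<close> and \<open>(v, s)\<close>, so the forgetful functors return its four
  structure maps; at the free objects \<open>G\<^sub>A x\<close> and \<open>G\<^sub>B y\<close> these are the multiplications, actions and
  evaluation maps of \<open>T\<close> (\<open>radj_eps_simps\<close>, \<open>Upsilon_Gamma_obj\<close>).

  On an arrow \<open>\<phi> : T \<rightarrow> T'\<close> one has to compute the mates of the restriction functor along \<open>\<phi>\<close>.
  The mate for the first adjunction has at \<open>x\<close> the first component \<open>m' \<circ> \<phi>\<^sub>1 (A' x) \<circ> A (u' x)\<close>, with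
  \<open>m', u'\<close> the structure of the monad \<open>A'\<close>. Naturality of \<open>\<phi>\<^sub>1\<close> turns it into
  \<open>m' \<circ> A' (u' x) \<circ> \<phi>\<^sub>1 x\<close>, which is \<open>\<phi>\<^sub>1 x\<close> by the unit law. The other three components are recovered
  in the same way from the unit laws of \<open>B'\<close> and of the two right actions (\<open>natural_retract\<close>,
  \<open>Upsilon_Gamma_map\<close>).

  Most of the work is to see that the two assignments are functors at all. For double adjunctions to
  Morita contexts this is uniform in the three indices of a map \<open>R\<^sub>i \<epsilon>\<^sub>k L\<^sub>j\<close>. The sixteen
  associativity-like axioms say that one counit is natural with respect to the components of another
  (\<open>counit_exchange\<close>), the unit axioms are triangle identities, and the eight compatibility equations
  of an arrow are instances of \<open>mate_square\<close>. In the other direction, the axioms of a Morita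
  context make \<open>G\<^sub>A x\<close> and \<open>G\<^sub>B y\<close> Eilenberg-Moore objects, and the laws of an Eilenberg-Moore
  object other than the unit laws say exactly that the counits at it are morphisms. Restriction along \<open>\<phi>\<close> preserves
  Eilenberg-Moore objects because each of the eight equations of \<open>\<phi>\<close> can be pasted to the corresponding
  law of the object (\<open>square_paste\<close>).
\<close>


section \<open>Categories, functors and natural transformations\<close>

lemma mem_hom: "f \<in> hom C a b \<longleftrightarrow> f \<in> Arr C \<and> Dom C f = a \<and> Cod C f = b"
  by (simp add: hom_def)

text \<open>
  Typing is stated through \<open>Dom\<close> and \<open>Cod\<close> rather than through \<open>hom\<close>: all premises then have no
  variables besides those of the rewritten term, and the simplifier decides composability by itself.
  Together with associativity and the functor laws it brings every composite to a right-nested word with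
  the functors pushed inside, so a diagram chase reduces to naming the equations of its cells.
\<close>

context category
begin

lemma Ide_simps [simp]:
  assumes "a \<in> Obj C"
  shows "Ide C a \<in> Arr C" "Dom C (Ide C a) = a" "Cod C (Ide C a) = a"
  using Ide_hom[OF assms] by (auto simp: mem_hom)

lemma Comp_simps [simp]:
  assumes "f \<in> Arr C" "g \<in> Arr C" "Dom C g = Cod C f"
  shows "g \<cdot> f \<in> Arr C" "Dom C (g \<cdot> f) = Dom C f" "Cod C (g \<cdot> f) = Cod C g"
  using Comp_hom[of f "Dom C f" "Cod C f" g "Cod C g"] assms by (auto simp: mem_hom)

lemmas [simp] = Dom_Obj Cod_Obj Comp_assoc

lemma Comp_Ide [simp]:
  "f \<in> Arr C \<Longrightarrow> Dom C f = a \<Longrightarrow> f \<cdot> Ide C a = f"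
  "f \<in> Arr C \<Longrightarrow> Cod C f = b \<Longrightarrow> Ide C b \<cdot> f = f"
  using Comp_Ide_Dom Comp_Ide_Cod by auto

end

lemma categoryI:
  assumes "\<And>f. f \<in> Arr C \<Longrightarrow> Dom C f \<in> Obj C" "\<And>f. f \<in> Arr C \<Longrightarrow> Cod C f \<in> Obj C"
    and "\<And>a. a \<in> Obj C \<Longrightarrow> Ide C a \<in> Arr C" "\<And>a. a \<in> Obj C \<Longrightarrow> Dom C (Ide C a) = a"
      "\<And>a. a \<in> Obj C \<Longrightarrow> Cod C (Ide C a) = a"
    and "\<And>f g. f \<in> Arr C \<Longrightarrow> g \<in> Arr C \<Longrightarrow> Dom C g = Cod C f \<Longrightarrow>
      g \<cdot>\<^bsub>C\<^esub> f \<in> Arr C \<and> Dom C (g \<cdot>\<^bsub>C\<^esub> f) = Dom C f \<and> Cod C (g \<cdot>\<^bsub>C\<^esub> f) = Cod C g"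
    and "\<And>f. f \<in> Arr C \<Longrightarrow> f \<cdot>\<^bsub>C\<^esub> Ide C (Dom C f) = f"
      "\<And>f. f \<in> Arr C \<Longrightarrow> Ide C (Cod C f) \<cdot>\<^bsub>C\<^esub> f = f"
    and "\<And>f g h. f \<in> Arr C \<Longrightarrow> g \<in> Arr C \<Longrightarrow> h \<in> Arr C \<Longrightarrow>
      Dom C g = Cod C f \<Longrightarrow> Dom C h = Cod C g \<Longrightarrow>
      (h \<cdot>\<^bsub>C\<^esub> g) \<cdot>\<^bsub>C\<^esub> f = h \<cdot>\<^bsub>C\<^esub> (g \<cdot>\<^bsub>C\<^esub> f)"
  shows "category C"
  by unfold_locales (use assms in \<open>simp_all add: mem_hom\<close>)

context is_functor
begin

lemma Fo_Obj [simp]: "a \<in> Obj C \<Longrightarrow> Fo F a \<in> Obj D"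
  using Fo_ext by auto

lemma Fo_extensional: "Fo F \<in> extensional (Obj C)"
  using Fo_ext by (simp add: PiE_def)

lemma Fa_simps [simp]:
  assumes "f \<in> Arr C"
  shows "Fa F f \<in> Arr D" "Dom D (Fa F f) = Fo F (Dom C f)" "Cod D (Fa F f) = Fo F (Cod C f)"
  using Fa_hom[of f "Dom C f" "Cod C f"] assms by (auto simp: mem_hom)

lemmas [simp] = Fa_Ide Fa_Comp

text \<open>
  Morphisms of algebras, and more generally pairs of arrows intertwining two maps along \<open>F\<close>,
  can be composed.
\<close>

lemma square_stack:
  assumes "g \<cdot>\<^bsub>D\<^esub> r = r' \<cdot>\<^bsub>D\<^esub> Fa F f" "k \<cdot>\<^bsub>D\<^esub> r' = r'' \<cdot>\<^bsub>D\<^esub> Fa F h"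
    and "f \<in> Arr C" "h \<in> Arr C" "Dom C h = Cod C f"
    and "r \<in> Arr D" "r' \<in> Arr D" "r'' \<in> Arr D" "g \<in> Arr D" "k \<in> Arr D"
    and "Dom D g = Cod D r" "Dom D k = Cod D g" "Cod D r' = Cod D g"
    and "Dom D r' = Fo F (Cod C f)" "Dom D r'' = Fo F (Cod C h)"
  shows "(k \<cdot>\<^bsub>D\<^esub> g) \<cdot>\<^bsub>D\<^esub> r = r'' \<cdot>\<^bsub>D\<^esub> Fa F (h \<cdot>\<^bsub>C\<^esub> f)"
proof -
  have "(k \<cdot>\<^bsub>D\<^esub> g) \<cdot>\<^bsub>D\<^esub> r = (k \<cdot>\<^bsub>D\<^esub> r') \<cdot>\<^bsub>D\<^esub> Fa F f"
    using assms(1,3-) by simp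
  then show ?thesis using assms(2-) by simp
qed

end

lemma is_functorI:
  assumes "category C" "category D"
    and "Fo F \<in> extensional (Obj C)" "Fa F \<in> extensional (Arr C)"
    and "\<And>a. a \<in> Obj C \<Longrightarrow> Fo F a \<in> Obj D"
    and "\<And>f. f \<in> Arr C \<Longrightarrow> Fa F f \<in> Arr D \<and>
      Dom D (Fa F f) = Fo F (Dom C f) \<and> Cod D (Fa F f) = Fo F (Cod C f)"
    and "\<And>a. a \<in> Obj C \<Longrightarrow> Fa F (Ide C a) = Ide D (Fo F a)"
    and "\<And>f g. f \<in> Arr C \<Longrightarrow> g \<in> Arr C \<Longrightarrow> Dom C g = Cod C f \<Longrightarrow>
      Fa F (g \<cdot>\<^bsub>C\<^esub> f) = Fa F g \<cdot>\<^bsub>D\<^esub> Fa F f"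
  shows "is_functor C D F"
  using assms by (auto simp: is_functor_def is_functor_axioms_def mem_hom PiE_def)

lemma ftor_eqI:
  assumes "is_functor C D F" "is_functor C D' G"
    and "\<And>a. a \<in> Obj C \<Longrightarrow> Fo F a = Fo G a" "\<And>f. f \<in> Arr C \<Longrightarrow> Fa F f = Fa G f"
  shows "F = G"
proof -
  interpret F: is_functor C D F by fact
  interpret G: is_functor C D' G by fact
  have "Fo F = Fo G" "Fa F = Fa G"
    using assms(3,4) by (auto intro: extensionalityI F.Fo_extensional G.Fo_extensional F.Fa_ext G.Fa_ext)
  then show ?thesis by (cases F, cases G) simp
qed

lemma ftor_id_simps [simp]:
  "a \<in> Obj C \<Longrightarrow> Fo (ftor_id C) a = a" "f \<in> Arr C \<Longrightarrow> Fa (ftor_id C) f = f"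
  by (simp_all add: ftor_id_def)

lemma ftor_comp_simps [simp]:
  "a \<in> Obj C \<Longrightarrow> Fo (ftor_comp C G F) a = Fo G (Fo F a)"
  "f \<in> Arr C \<Longrightarrow> Fa (ftor_comp C G F) f = Fa G (Fa F f)"
  by (simp_all add: ftor_comp_def)

lemma is_functor_ftor_id: "category C \<Longrightarrow> is_functor C C (ftor_id C)"
proof -
  assume "category C"
  then interpret category C .
  show ?thesis by (rule is_functorI) (auto simp: \<open>category C\<close> ftor_id_def)
qed

lemma is_functor_ftor_comp:
  assumes "is_functor C D F" "is_functor D E G"
  shows "is_functor C E (ftor_comp C G F)"
proof -
  interpret F: is_functor C D F by fact
  interpret G: is_functor D E G by fact
  show ?thesis
    by (rule is_functorI)
      (auto simp: F.C.category_axioms G.D.category_axioms, auto simp: ftor_comp_def)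
qed

lemma ftor_comp_assoc:
  assumes "is_functor C D F" "is_functor D E G" "is_functor E E' H"
  shows "ftor_comp C (ftor_comp D H G) F = ftor_comp C H (ftor_comp C G F)"
proof -
  interpret F: is_functor C D F by fact
  show ?thesis
    by (rule ftor_eqI) (use assms in \<open>auto intro!: is_functor_ftor_comp\<close>)
qed

lemma ftor_comp_id:
  assumes "is_functor C D F"
  shows "ftor_comp C F (ftor_id C) = F" "ftor_comp C (ftor_id D) F = F"
proof -
  interpret F: is_functor C D F by fact
  show "ftor_comp C F (ftor_id C) = F"
    by (rule ftor_eqI[OF is_functor_ftor_comp[OF is_functor_ftor_id assms] assms])
      (simp_all add: F.C.category_axioms)
  show "ftor_comp C (ftor_id D) F = F"
    by (rule ftor_eqI[OF is_functor_ftor_comp[OF assms is_functor_ftor_id] assms])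
      (simp_all add: F.D.category_axioms)
qed

context is_nat_trans
begin

lemma component_simps [simp]:
  assumes "a \<in> Obj C"
  shows "t a \<in> Arr D" "Dom D (t a) = Fo F a" "Cod D (t a) = Fo G a"
  using comp_hom[OF assms] by (auto simp: mem_hom)

lemma natural: "f \<in> Arr C \<Longrightarrow> t (Cod C f) \<cdot>\<^bsub>D\<^esub> Fa F f = Fa G f \<cdot>\<^bsub>D\<^esub> t (Dom C f)"
  using naturality[of f "Dom C f" "Cod C f"] by (simp add: mem_hom)

end

lemma is_nat_transI:
  assumes "is_functor C D F" "is_functor C D G" "t \<in> extensional (Obj C)"
    and "\<And>a. a \<in> Obj C \<Longrightarrow> t a \<in> Arr D \<and> Dom D (t a) = Fo F a \<and> Cod D (t a) = Fo G a"
    and "\<And>f. f \<in> Arr C \<Longrightarrow> t (Cod C f) \<cdot>\<^bsub>D\<^esub> Fa F f = Fa G f \<cdot>\<^bsub>D\<^esub> t (Dom C f)"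
  shows "is_nat_trans C D F G t"
  using assms by (auto simp: is_nat_trans_def is_nat_trans_axioms_def mem_hom)

lemma is_nat_trans_Ide:
  assumes "is_functor C D F"
  shows "is_nat_trans C D F F (\<lambda>a\<in>Obj C. Ide D (Fo F a))"
proof -
  interpret is_functor C D F by fact
  show ?thesis by (rule is_nat_transI) (simp_all add: is_functor_axioms)
qed

lemma is_nat_trans_Comp:
  assumes "is_nat_trans C D F G s" "is_nat_trans C D G H t"
  shows "is_nat_trans C D F H (\<lambda>a\<in>Obj C. t a \<cdot>\<^bsub>D\<^esub> s a)"
proof -
  interpret s: is_nat_trans C D F G s by fact
  interpret t: is_nat_trans C D G H t by fact
  show ?thesis
  proof (rule is_nat_transI)
    fix f assume f: "f \<in> Arr C"
    have "t (Cod C f) \<cdot>\<^bsub>D\<^esub> s (Cod C f) \<cdot>\<^bsub>D\<^esub> Fa F f = (t (Cod C f) \<cdot>\<^bsub>D\<^esub> Fa G f) \<cdot>\<^bsub>D\<^esub> s (Dom C f)"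
      using f s.natural[OF f] by simp
    then show "(\<lambda>a\<in>Obj C. t a \<cdot>\<^bsub>D\<^esub> s a) (Cod C f) \<cdot>\<^bsub>D\<^esub> Fa F f =
        Fa H f \<cdot>\<^bsub>D\<^esub> (\<lambda>a\<in>Obj C. t a \<cdot>\<^bsub>D\<^esub> s a) (Dom C f)"
      using f t.natural[OF f] by simp
  qed (simp_all add: s.F.is_functor_axioms t.G.is_functor_axioms)
qed


section \<open>The category of Morita contexts\<close>

text \<open>
  The left-hand premise is a square from \<open>\<alpha>\<close> to \<open>\<alpha>'\<close> whose Godement product is \<open>t * u\<close>; naturality
  of \<open>t\<close> at \<open>e\<close> lets it be pasted to any square with source \<open>\<alpha>'\<close>. This one shape serves for the
  composition of arrows of Morita contexts, where \<open>\<beta>\<close> contains a component of the second arrow, and for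
  the restriction of Eilenberg-Moore objects, where \<open>k\<close>, \<open>\<beta>\<close> and \<open>e\<close> are structure maps.
\<close>

lemma (in is_nat_trans) square_paste:
  assumes "h \<cdot>\<^bsub>D\<^esub> \<alpha> = \<alpha>' \<cdot>\<^bsub>D\<^esub> (t b \<cdot>\<^bsub>D\<^esub> Fa F u)" "k \<cdot>\<^bsub>D\<^esub> \<alpha>' = \<beta> \<cdot>\<^bsub>D\<^esub> Fa G e"
    and "u \<in> Arr C" "Cod C u = b" "e \<in> Arr C" "Dom C e = b"
    and "\<alpha> \<in> Arr D" "h \<in> Arr D" "Dom D h = Cod D \<alpha>" "k \<in> Arr D" "Dom D k = Cod D h"
    and "\<alpha>' \<in> Arr D" "Dom D \<alpha>' = Fo G b" "Cod D \<alpha>' = Dom D k"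
    and "\<beta> \<in> Arr D" "Dom D \<beta> = Fo G (Cod C e)"
  shows "(k \<cdot>\<^bsub>D\<^esub> h) \<cdot>\<^bsub>D\<^esub> \<alpha> = (\<beta> \<cdot>\<^bsub>D\<^esub> t (Cod C e)) \<cdot>\<^bsub>D\<^esub> Fa F (e \<cdot>\<^bsub>C\<^esub> u)"
proof -
  have [simp]: "b \<in> Obj C" using assms(3,4) by auto
  have "(k \<cdot>\<^bsub>D\<^esub> h) \<cdot>\<^bsub>D\<^esub> \<alpha> = (k \<cdot>\<^bsub>D\<^esub> \<alpha>') \<cdot>\<^bsub>D\<^esub> t b \<cdot>\<^bsub>D\<^esub> Fa F u"
    using assms(1,3-) by simp
  also have "\<dots> = \<beta> \<cdot>\<^bsub>D\<^esub> (Fa G e \<cdot>\<^bsub>D\<^esub> t b) \<cdot>\<^bsub>D\<^esub> Fa F u"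
    using assms(2-) by simp
  also have "Fa G e \<cdot>\<^bsub>D\<^esub> t b = t (Cod C e) \<cdot>\<^bsub>D\<^esub> Fa F e"
    using natural[OF \<open>e \<in> Arr C\<close>] assms(6) by simp
  finally show ?thesis using assms(3-) by simp
qed

lemma (in is_nat_trans) square_compose:
  assumes "h \<cdot>\<^bsub>D\<^esub> \<alpha> = \<alpha>' \<cdot>\<^bsub>D\<^esub> (t b \<cdot>\<^bsub>D\<^esub> Fa F u)"
    and "k \<cdot>\<^bsub>D\<^esub> \<alpha>' = \<alpha>'' \<cdot>\<^bsub>D\<^esub> (s \<cdot>\<^bsub>D\<^esub> Fa G e)"
    and "u \<in> Arr C" "Cod C u = b" "e \<in> Arr C" "Dom C e = b"
    and "\<alpha> \<in> Arr D" "h \<in> Arr D" "Dom D h = Cod D \<alpha>" "k \<in> Arr D" "Dom D k = Cod D h"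
    and "\<alpha>' \<in> Arr D" "Dom D \<alpha>' = Fo G b" "Cod D \<alpha>' = Dom D k"
    and "\<alpha>'' \<in> Arr D" "Dom D \<alpha>'' = Cod D s" "s \<in> Arr D" "Dom D s = Fo G (Cod C e)"
  shows "(k \<cdot>\<^bsub>D\<^esub> h) \<cdot>\<^bsub>D\<^esub> \<alpha> = \<alpha>'' \<cdot>\<^bsub>D\<^esub> ((s \<cdot>\<^bsub>D\<^esub> t (Cod C e)) \<cdot>\<^bsub>D\<^esub> Fa F (e \<cdot>\<^bsub>C\<^esub> u))"
proof -
  have "k \<cdot>\<^bsub>D\<^esub> \<alpha>' = (\<alpha>'' \<cdot>\<^bsub>D\<^esub> s) \<cdot>\<^bsub>D\<^esub> Fa G e"
    using assms(2-) by simp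
  then show ?thesis
    using square_paste[of h \<alpha> \<alpha>' b u k "\<alpha>'' \<cdot>\<^bsub>D\<^esub> s" e, OF assms(1)] assms(3-) by simp
qed

text \<open>
  Here all eight compatibility equations use the same form \<open>s (F' a) \<circ> G (t a)\<close> of the Godement
  product, also those for the two right actions. The forms agree by naturality of \<open>\<phi>\<^sub>3\<close> and \<open>\<phi>\<^sub>4\<close>,
  and the common form is what allows one argument to treat all eight.
\<close>

lemma is_morita_morI:
  assumes "is_morita \<X> \<Y> T" "is_morita \<X> \<Y> T'"
    and p1: "is_nat_trans \<X> \<X> (fA T) (fA T') (phi1 p)"
    and p2: "is_nat_trans \<Y> \<Y> (fB T) (fB T') (phi2 p)"
    and p3: "is_nat_trans \<Y> \<X> (fT T) (fT T') (phi3 p)"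
    and p4: "is_nat_trans \<X> \<Y> (fTh T) (fTh T') (phi4 p)"
    and u1: "\<And>x. x \<in> Obj \<X> \<Longrightarrow> phi1 p x \<cdot>\<^bsub>\<X>\<^esub> unit (mnA T) x = unit (mnA T') x"
    and u2: "\<And>y. y \<in> Obj \<Y> \<Longrightarrow> phi2 p y \<cdot>\<^bsub>\<Y>\<^esub> unit (mnB T) y = unit (mnB T') y"
    and m1: "\<And>x. x \<in> Obj \<X> \<Longrightarrow> phi1 p x \<cdot>\<^bsub>\<X>\<^esub> mul (mnA T) x =
      mul (mnA T') x \<cdot>\<^bsub>\<X>\<^esub> (phi1 p (Fo (fA T') x) \<cdot>\<^bsub>\<X>\<^esub> Fa (fA T) (phi1 p x))"
    and m2: "\<And>y. y \<in> Obj \<Y> \<Longrightarrow> phi2 p y \<cdot>\<^bsub>\<Y>\<^esub> mul (mnB T) y =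
      mul (mnB T') y \<cdot>\<^bsub>\<Y>\<^esub> (phi2 p (Fo (fB T') y) \<cdot>\<^bsub>\<Y>\<^esub> Fa (fB T) (phi2 p y))"
    and rho: "\<And>y. y \<in> Obj \<Y> \<Longrightarrow> phi3 p y \<cdot>\<^bsub>\<X>\<^esub> rho T y =
      rho T' y \<cdot>\<^bsub>\<X>\<^esub> (phi3 p (Fo (fB T') y) \<cdot>\<^bsub>\<X>\<^esub> Fa (fT T) (phi2 p y))"
    and lam: "\<And>y. y \<in> Obj \<Y> \<Longrightarrow> phi3 p y \<cdot>\<^bsub>\<X>\<^esub> lam T y =
      lam T' y \<cdot>\<^bsub>\<X>\<^esub> (phi1 p (Fo (fT T') y) \<cdot>\<^bsub>\<X>\<^esub> Fa (fA T) (phi3 p y))"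
    and rhoh: "\<And>x. x \<in> Obj \<X> \<Longrightarrow> phi4 p x \<cdot>\<^bsub>\<Y>\<^esub> rhoh T x =
      rhoh T' x \<cdot>\<^bsub>\<Y>\<^esub> (phi4 p (Fo (fA T') x) \<cdot>\<^bsub>\<Y>\<^esub> Fa (fTh T) (phi1 p x))"
    and lamh: "\<And>x. x \<in> Obj \<X> \<Longrightarrow> phi4 p x \<cdot>\<^bsub>\<Y>\<^esub> lamh T x =
      lamh T' x \<cdot>\<^bsub>\<Y>\<^esub> (phi2 p (Fo (fTh T') x) \<cdot>\<^bsub>\<Y>\<^esub> Fa (fB T) (phi4 p x))"
    and ev: "\<And>x. x \<in> Obj \<X> \<Longrightarrow> phi1 p x \<cdot>\<^bsub>\<X>\<^esub> ev T x =
      ev T' x \<cdot>\<^bsub>\<X>\<^esub> (phi3 p (Fo (fTh T') x) \<cdot>\<^bsub>\<X>\<^esub> Fa (fT T) (phi4 p x))"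
    and evh: "\<And>y. y \<in> Obj \<Y> \<Longrightarrow> phi2 p y \<cdot>\<^bsub>\<Y>\<^esub> evh T y =
      evh T' y \<cdot>\<^bsub>\<Y>\<^esub> (phi4 p (Fo (fT T') y) \<cdot>\<^bsub>\<Y>\<^esub> Fa (fTh T) (phi3 p y))"
  shows "is_morita_mor \<X> \<Y> T T' p"
proof -
  interpret S: is_morita \<X> \<Y> T by fact
  interpret S': is_morita \<X> \<Y> T' by fact
  interpret p1: is_nat_trans \<X> \<X> "fA T" "fA T'" "phi1 p" by fact
  interpret p2: is_nat_trans \<Y> \<Y> "fB T" "fB T'" "phi2 p" by fact
  interpret p3: is_nat_trans \<Y> \<X> "fT T" "fT T'" "phi3 p" by fact
  interpret p4: is_nat_trans \<X> \<Y> "fTh T" "fTh T'" "phi4 p" by fact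
  show ?thesis
  proof (unfold_locales, goal_cases)
    case (5 y)
    then show ?case using rho[of y] p3.natural[of "phi2 p y"] by simp
  next
    case (7 x)
    then show ?case using rhoh[of x] p4.natural[of "phi1 p x"] by simp
  qed (rule u1 u2 m1 m2 lam lamh ev evh; assumption)+
qed

context is_morita_mor
begin

lemma phi3_rho_outer:
  "y \<in> Obj \<Y> \<Longrightarrow> phi3 p y \<cdot>\<^bsub>\<X>\<^esub> rho T y =
    rho T' y \<cdot>\<^bsub>\<X>\<^esub> (phi3 p (Fo (fB T') y) \<cdot>\<^bsub>\<X>\<^esub> Fa (fT T) (phi2 p y))"
  using phi3_rho[of y] p3.natural[of "phi2 p y"] by simp

lemma phi4_rhoh_outer:
  "x \<in> Obj \<X> \<Longrightarrow> phi4 p x \<cdot>\<^bsub>\<Y>\<^esub> rhoh T x =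
    rhoh T' x \<cdot>\<^bsub>\<Y>\<^esub> (phi4 p (Fo (fA T') x) \<cdot>\<^bsub>\<Y>\<^esub> Fa (fTh T) (phi1 p x))"
  using phi4_rhoh[of x] p4.natural[of "phi1 p x"] by simp

lemmas squares = p1.mor_mul p2.mor_mul phi3_rho_outer phi3_lam phi4_rhoh_outer phi4_lamh
  phi1_ev phi2_evh

end

lemma morita_map_eqI:
  fixes p q :: "('xo, 'xm, 'yo, 'ym) morita_map"
  assumes "is_morita_mor \<X> \<Y> T T' p" "is_morita_mor \<X> \<Y> S S' q"
    and "\<And>x. x \<in> Obj \<X> \<Longrightarrow> phi1 p x = phi1 q x" "\<And>y. y \<in> Obj \<Y> \<Longrightarrow> phi2 p y = phi2 q y"
      "\<And>y. y \<in> Obj \<Y> \<Longrightarrow> phi3 p y = phi3 q y" "\<And>x. x \<in> Obj \<X> \<Longrightarrow> phi4 p x = phi4 q x"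
  shows "p = q"
proof -
  interpret p: is_morita_mor \<X> \<Y> T T' p by fact
  interpret q: is_morita_mor \<X> \<Y> S S' q by fact
  note ext = p.p1.comp_ext p.p2.comp_ext p.p3.comp_ext p.p4.comp_ext
    q.p1.comp_ext q.p2.comp_ext q.p3.comp_ext q.p4.comp_ext
  have "phi1 p = phi1 q" "phi2 p = phi2 q" "phi3 p = phi3 q" "phi4 p = phi4 q"
    using assms(3-) by (auto intro: extensionalityI ext)
  then show ?thesis by (cases p, cases q) simp
qed

lemma is_morita_mor_Ide:
  assumes "is_morita \<X> \<Y> T"
  shows "is_morita_mor \<X> \<Y> T T (Map (Ide (Mor \<X> \<Y>) T))"
proof -
  interpret is_morita \<X> \<Y> T by fact
  show ?thesis
    by (rule is_morita_morI)
      (simp_all add: Mor_def assms is_nat_trans_Ide T.A.mul.G.is_functor_axioms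
        T.B.mul.G.is_functor_axioms T.T.is_functor_axioms Th.T.is_functor_axioms)
qed

lemma is_morita_mor_Comp:
  assumes "is_morita_mor \<X> \<Y> (Src p) (Tgt p) (Map p)" "is_morita_mor \<X> \<Y> (Src q) (Tgt q) (Map q)"
    and "Src q = Tgt p"
  shows "is_morita_mor \<X> \<Y> (Src p) (Tgt q) (Map (q \<cdot>\<^bsub>Mor \<X> \<Y>\<^esub> p))"
proof -
  interpret p: is_morita_mor \<X> \<Y> "Src p" "Tgt p" "Map p" by fact
  interpret q: is_morita_mor \<X> \<Y> "Tgt p" "Tgt q" "Map q" using assms(2,3) by simp
  show ?thesis
  proof (rule is_morita_morI, goal_cases)
    case (7 x)
    have "phi1 (Map q) x \<cdot>\<^bsub>\<X>\<^esub> phi1 (Map p) x \<cdot>\<^bsub>\<X>\<^esub> unit (mnA (Src p)) x = unit (mnA (Tgt q)) x"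
      using 7 by (simp add: p.p1.mor_unit q.p1.mor_unit)
    then show ?case using 7 by (simp add: Mor_def)
  next
    case (8 y)
    have "phi2 (Map q) y \<cdot>\<^bsub>\<Y>\<^esub> phi2 (Map p) y \<cdot>\<^bsub>\<Y>\<^esub> unit (mnB (Src p)) y = unit (mnB (Tgt q)) y"
      using 8 by (simp add: p.p2.mor_unit q.p2.mor_unit)
    then show ?case using 8 by (simp add: Mor_def)
  next
    case (9 x)
    then show ?case
      using p.p1.square_compose[OF p.squares(1)[OF 9] q.squares(1)[OF 9]] by (simp add: Mor_def)
  next
    case (10 y)
    then show ?case
      using p.p2.square_compose[OF p.squares(2)[OF 10] q.squares(2)[OF 10]] by (simp add: Mor_def)
  next
    case (11 y)
    then show ?case
      using p.p3.square_compose[OF p.squares(3)[OF 11] q.squares(3)[OF 11]] by (simp add: Mor_def)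
  next
    case (12 y)
    then show ?case
      using p.p1.square_compose[OF p.squares(4)[OF 12] q.squares(4)[OF 12]] by (simp add: Mor_def)
  next
    case (13 x)
    then show ?case
      using p.p4.square_compose[OF p.squares(5)[OF 13] q.squares(5)[OF 13]] by (simp add: Mor_def)
  next
    case (14 x)
    then show ?case
      using p.p2.square_compose[OF p.squares(6)[OF 14] q.squares(6)[OF 14]] by (simp add: Mor_def)
  next
    case (15 x)
    then show ?case
      using p.p3.square_compose[OF p.squares(7)[OF 15] q.squares(7)[OF 15]] by (simp add: Mor_def)
  next
    case (16 y)
    then show ?case
      using p.p4.square_compose[OF p.squares(8)[OF 16] q.squares(8)[OF 16]] by (simp add: Mor_def)
  qed (simp_all add: Mor_def p.S.is_morita_axioms q.S'.is_morita_axioms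
      is_nat_trans_Comp[OF p.p1.is_nat_trans_axioms q.p1.is_nat_trans_axioms]
      is_nat_trans_Comp[OF p.p2.is_nat_trans_axioms q.p2.is_nat_trans_axioms]
      is_nat_trans_Comp[OF p.p3.is_nat_trans_axioms q.p3.is_nat_trans_axioms]
      is_nat_trans_Comp[OF p.p4.is_nat_trans_axioms q.p4.is_nat_trans_axioms])
qed

lemma Mor_simps [simp]:
  "Obj (Mor \<X> \<Y>) = {T. is_morita \<X> \<Y> T}"
  "Arr (Mor \<X> \<Y>) = {p. is_morita_mor \<X> \<Y> (Src p) (Tgt p) (Map p)}"
  "Dom (Mor \<X> \<Y>) = Src" "Cod (Mor \<X> \<Y>) = Tgt"
  "Src (Ide (Mor \<X> \<Y>) T) = T" "Tgt (Ide (Mor \<X> \<Y>) T) = T"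
  "Src (q \<cdot>\<^bsub>Mor \<X> \<Y>\<^esub> p) = Src p" "Tgt (q \<cdot>\<^bsub>Mor \<X> \<Y>\<^esub> p) = Tgt q"
  by (simp_all add: Mor_def)

lemma arrow_eqI: "Src p = Src q \<Longrightarrow> Tgt p = Tgt q \<Longrightarrow> Map p = Map q \<Longrightarrow> (p :: ('o, 'd) arrow) = q"
  by (cases p, cases q) simp

lemma category_Mor: "category (Mor \<X> \<Y>)"
proof (rule categoryI, goal_cases)
  case (6 f g)
  then show ?case by (simp add: is_morita_mor_Comp)
next
  case (7 f)
  then interpret f: is_morita_mor \<X> \<Y> "Src f" "Tgt f" "Map f" by simp
  have "is_morita_mor \<X> \<Y> (Src f) (Tgt f) (Map (f \<cdot>\<^bsub>Mor \<X> \<Y>\<^esub> Ide (Mor \<X> \<Y>) (Src f)))"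
    using is_morita_mor_Comp[of \<X> \<Y> "Ide (Mor \<X> \<Y>) (Src f)" f]
    by (simp add: is_morita_mor_Ide f.S.is_morita_axioms f.is_morita_mor_axioms)
  then have "Map (f \<cdot>\<^bsub>Mor \<X> \<Y>\<^esub> Ide (Mor \<X> \<Y>) (Src f)) = Map f"
    by (rule morita_map_eqI[OF _ f.is_morita_mor_axioms]) (simp_all add: Mor_def)
  then show ?case by (auto intro: arrow_eqI)
next
  case (8 f)
  then interpret f: is_morita_mor \<X> \<Y> "Src f" "Tgt f" "Map f" by simp
  have "is_morita_mor \<X> \<Y> (Src f) (Tgt f) (Map (Ide (Mor \<X> \<Y>) (Tgt f) \<cdot>\<^bsub>Mor \<X> \<Y>\<^esub> f))"
    using is_morita_mor_Comp[of \<X> \<Y> f "Ide (Mor \<X> \<Y>) (Tgt f)"]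
    by (simp add: is_morita_mor_Ide f.S'.is_morita_axioms f.is_morita_mor_axioms)
  then have "Map (Ide (Mor \<X> \<Y>) (Tgt f) \<cdot>\<^bsub>Mor \<X> \<Y>\<^esub> f) = Map f"
    by (rule morita_map_eqI[OF _ f.is_morita_mor_axioms]) (simp_all add: Mor_def)
  then show ?case by (auto intro: arrow_eqI)
next
  case (9 f g h)
  then interpret f: is_morita_mor \<X> \<Y> "Src f" "Tgt f" "Map f" by simp
  interpret g: is_morita_mor \<X> \<Y> "Tgt f" "Tgt g" "Map g" using 9 by simp
  interpret h: is_morita_mor \<X> \<Y> "Tgt g" "Tgt h" "Map h" using 9 by simp
  show ?case by (simp add: Mor_def cong: restrict_cong)
qed (auto simp: is_morita_mor_Ide dest: is_morita_mor.axioms)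


section \<open>The category of double adjunctions\<close>

lemma Adj_simps [simp]:
  "Obj (Adj \<X> \<Y>) = {Z. is_dadj \<X> \<Y> Z}"
  "Arr (Adj \<X> \<Y>) = {F. is_dadj_mor \<X> \<Y> (Src F) (Tgt F) (Map F)}"
  "Dom (Adj \<X> \<Y>) = Src" "Cod (Adj \<X> \<Y>) = Tgt"
  "Ide (Adj \<X> \<Y>) Z = \<lparr>Src = Z, Tgt = Z, Map = ftor_id (apex Z)\<rparr>"
  "G \<cdot>\<^bsub>Adj \<X> \<Y>\<^esub> F = \<lparr>Src = Src F, Tgt = Tgt G, Map = ftor_comp (apex (Tgt G)) (Map F) (Map G)\<rparr>"
  by (simp_all add: Adj_def)

lemma is_dadj_mor_Ide:
  assumes "is_dadj \<X> \<Y> Z"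
  shows "is_dadj_mor \<X> \<Y> Z Z (ftor_id (apex Z))"
proof -
  interpret is_dadj \<X> \<Y> Z by fact
  show ?thesis
    using assms is_functor_ftor_id[OF A.L.D.category_axioms] A.R.is_functor_axioms B.R.is_functor_axioms
    by (simp add: is_dadj_mor_def is_dadj_mor_axioms_def ftor_comp_id)
qed

lemma is_dadj_mor_Comp:
  assumes "is_dadj_mor \<X> \<Y> Z Z' F" "is_dadj_mor \<X> \<Y> Z' Z'' G"
  shows "is_dadj_mor \<X> \<Y> Z Z'' (ftor_comp (apex Z'') F G)"
proof -
  interpret F: is_dadj_mor \<X> \<Y> Z Z' F by fact
  interpret G: is_dadj_mor \<X> \<Y> Z' Z'' G by fact
  note FG = G.F.is_functor_axioms F.F.is_functor_axioms
  have "ftor_comp (apex Z'') (RA Z) (ftor_comp (apex Z'') F G) = RA Z''"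
    using ftor_comp_assoc[OF FG F.S.A.R.is_functor_axioms] F.RA_comp G.RA_comp by simp
  moreover have "ftor_comp (apex Z'') (RB Z) (ftor_comp (apex Z'') F G) = RB Z''"
    using ftor_comp_assoc[OF FG F.S.B.R.is_functor_axioms] F.RB_comp G.RB_comp by simp
  ultimately show ?thesis
    using is_functor_ftor_comp[OF FG] F.S.is_dadj_axioms G.S'.is_dadj_axioms
    by (simp add: is_dadj_mor_def is_dadj_mor_axioms_def)
qed

lemma category_Adj: "category (Adj \<X> \<Y>)"
proof (rule categoryI, goal_cases)
  case (6 f g)
  then show ?case by (simp add: is_dadj_mor_Comp)
next
  case (7 f)
  then interpret f: is_dadj_mor \<X> \<Y> "Src f" "Tgt f" "Map f" by simp
  show ?case using ftor_comp_id[OF f.F.is_functor_axioms] by simp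
next
  case (8 f)
  then interpret f: is_dadj_mor \<X> \<Y> "Src f" "Tgt f" "Map f" by simp
  show ?case using ftor_comp_id[OF f.F.is_functor_axioms] by simp
next
  case (9 f g h)
  then interpret f: is_dadj_mor \<X> \<Y> "Src f" "Tgt f" "Map f" by simp
  interpret g: is_dadj_mor \<X> \<Y> "Tgt f" "Tgt g" "Map g" using 9 by simp
  interpret h: is_dadj_mor \<X> \<Y> "Tgt g" "Tgt h" "Map h" using 9 by simp
  show ?case
    using ftor_comp_assoc[OF h.F.is_functor_axioms g.F.is_functor_axioms f.F.is_functor_axioms] by simp
qed (auto simp: is_dadj_mor_Ide dest: is_dadj_mor.axioms)


section \<open>The functor from double adjunctions to Morita contexts\<close>

text \<open>
  The natural transformation \<open>R \<epsilon> L\<close>, without a constraint on where \<open>L\<close> starts and where \<open>R\<close> ends.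
  The multiplications, the four actions and the two evaluation maps of the Morita context of a double
  adjunction are its eight instances.
\<close>

definition whisker_counit :: "('wo, 'wm) cat \<Rightarrow> ('zo, 'zm, 'xo, 'xm) ftor \<Rightarrow>
    ('yo, 'ym, 'zo, 'zm) adjunction \<Rightarrow> ('wo, 'wm, 'zo, 'zm) ftor \<Rightarrow> 'wo \<Rightarrow> 'xm" where
  "whisker_counit \<W> R H L = (\<lambda>w\<in>Obj \<W>. Fa R (eps H (Fo L w)))"

lemma whisker_counit_apply [simp]:
  "w \<in> Obj \<W> \<Longrightarrow> whisker_counit \<W> R H L w = Fa R (eps H (Fo L w))"
  by (simp add: whisker_counit_def)

definition adj_monad :: "('xo, 'xm) cat \<Rightarrow> ('xo, 'xm, 'zo, 'zm) adjunction \<Rightarrow> ('xo, 'xm) monad" where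
  "adj_monad \<X> H =
    \<lparr>fn = ftor_comp \<X> (radj H) (ladj H), mul = whisker_counit \<X> (radj H) H (ladj H), unit = eta H\<rparr>"

definition adj_bialg :: "('yo, 'ym) cat \<Rightarrow> ('xo, 'xm, 'zo, 'zm) adjunction \<Rightarrow>
    ('yo, 'ym, 'zo, 'zm) adjunction \<Rightarrow> ('xo, 'xm, 'yo, 'ym) bialg" where
  "adj_bialg \<Y> H K =
    \<lparr>bf = ftor_comp \<Y> (radj H) (ladj K), lact = whisker_counit \<Y> (radj H) H (ladj K),
     ract = whisker_counit \<Y> (radj H) K (ladj K)\<rparr>"

lemma adj_monad_simps [simp]:
  "fn (adj_monad \<X> H) = ftor_comp \<X> (radj H) (ladj H)"
  "mul (adj_monad \<X> H) = whisker_counit \<X> (radj H) H (ladj H)"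
  "unit (adj_monad \<X> H) = eta H"
  by (simp_all add: adj_monad_def)

lemma adj_bialg_simps [simp]:
  "bf (adj_bialg \<Y> H K) = ftor_comp \<Y> (radj H) (ladj K)"
  "lact (adj_bialg \<Y> H K) = whisker_counit \<Y> (radj H) H (ladj K)"
  "ract (adj_bialg \<Y> H K) = whisker_counit \<Y> (radj H) K (ladj K)"
  by (simp_all add: adj_bialg_def)

lemma Upsilon_obj_eq:
  "Upsilon_obj \<X> \<Y> Z = \<lparr>mnA = adj_monad \<X> (adjA Z), mnB = adj_monad \<Y> (adjB Z),
    bim = adj_bialg \<Y> (adjA Z) (adjB Z), bimh = adj_bialg \<X> (adjB Z) (adjA Z),
    ev = whisker_counit \<X> (RA Z) (adjB Z) (LA Z), evh = whisker_counit \<Y> (RB Z) (adjA Z) (LB Z)\<rparr>"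
  by (simp add: Upsilon_obj_def adj_monad_def adj_bialg_def whisker_counit_def)

context is_adjunction
begin

lemma eps_natural:
  "f \<in> Arr \<Z> \<Longrightarrow> eps H (Cod \<Z> f) \<cdot>\<^bsub>\<Z>\<^esub> Fa (ladj H) (Fa (radj H) f) = f \<cdot>\<^bsub>\<Z>\<^esub> eps H (Dom \<Z> f)"
  using eps.natural[of f] by simp

lemma eta_natural:
  "f \<in> Arr \<X> \<Longrightarrow> eta H (Cod \<X> f) \<cdot>\<^bsub>\<X>\<^esub> f = Fa (radj H) (Fa (ladj H) f) \<cdot>\<^bsub>\<X>\<^esub> eta H (Dom \<X> f)"
  using eta.natural[of f] by simp

text \<open>
  Naturality of one counit at the components of another. For every choice of two adjunctions and of
  the outer functors this is an associativity-like axiom of a Morita context.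
\<close>

lemma counit_exchange:
  assumes "is_adjunction \<X>' \<Z> K" "is_functor \<Z> \<W> R" "z \<in> Obj \<Z>"
  shows "Fa R (eps H z) \<cdot>\<^bsub>\<W>\<^esub> Fa R (Fa (ladj H) (Fa (radj H) (eps K z))) =
    Fa R (eps K z) \<cdot>\<^bsub>\<W>\<^esub> Fa R (eps H (Fo (ladj K) (Fo (radj K) z)))"
proof -
  interpret K: is_adjunction \<X>' \<Z> K by fact
  interpret R: is_functor \<Z> \<W> R by fact
  show ?thesis
    using arg_cong[OF eps_natural[of "eps K z"], of "Fa R"] assms(3) by simp
qed

end

lemma is_nat_trans_whisker_counit:
  assumes "is_functor \<W> \<Z> L" "is_adjunction \<Y> \<Z> H" "is_functor \<Z> \<X> R"
  shows "is_nat_trans \<W> \<X> (ftor_comp \<W> (ftor_comp \<Y> R (ladj H)) (ftor_comp \<W> (radj H) L))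
    (ftor_comp \<W> R L) (whisker_counit \<W> R H L)"
proof -
  interpret L: is_functor \<W> \<Z> L by fact
  interpret H: is_adjunction \<Y> \<Z> H by fact
  interpret R: is_functor \<Z> \<X> R by fact
  show ?thesis
  proof (rule is_nat_transI)
    fix f assume "f \<in> Arr \<W>"
    then show "whisker_counit \<W> R H L (Cod \<W> f) \<cdot>\<^bsub>\<X>\<^esub>
        Fa (ftor_comp \<W> (ftor_comp \<Y> R (ladj H)) (ftor_comp \<W> (radj H) L)) f =
        Fa (ftor_comp \<W> R L) f \<cdot>\<^bsub>\<X>\<^esub> whisker_counit \<W> R H L (Dom \<W> f)"
      using arg_cong[OF H.eps_natural[of "Fa L f"], of "Fa R"] by simp
  qed (auto intro: is_functor_ftor_comp assms H.L.is_functor_axioms H.R.is_functor_axioms,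
      simp add: whisker_counit_def)
qed

lemma is_monad_adj_monad:
  assumes "is_adjunction \<X> \<Z> H"
  shows "is_monad \<X> (adj_monad \<X> H)"
proof -
  interpret H: is_adjunction \<X> \<Z> H by fact
  note nat = is_nat_trans_whisker_counit[OF H.L.is_functor_axioms assms H.R.is_functor_axioms]
  show ?thesis
    unfolding is_monad_def is_monad_axioms_def
  proof (intro conjI allI impI, goal_cases)
    case (4 x)
    then show ?case using H.counit_exchange[OF assms H.R.is_functor_axioms, of "Fo (ladj H) x"] by simp
  next
    case (5 x)
    then show ?case using H.triangle_R[of "Fo (ladj H) x"] by simp
  next
    case (6 x)
    then show ?case using arg_cong[OF H.triangle_L[of x], of "Fa (radj H)"] by simp
  qed (use nat in \<open>simp_all add: H.L.C.category_axioms H.eta.is_nat_trans_axioms\<close>)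
qed

lemma is_bialg_adj_bialg:
  assumes "is_adjunction \<X> \<Z> H" "is_adjunction \<Y> \<Z> K"
  shows "is_bialg \<X> \<Y> (adj_monad \<X> H) (adj_monad \<Y> K) (adj_bialg \<Y> H K)"
proof -
  interpret H: is_adjunction \<X> \<Z> H by fact
  interpret K: is_adjunction \<Y> \<Z> K by fact
  note functors = H.L.is_functor_axioms H.R.is_functor_axioms K.L.is_functor_axioms K.R.is_functor_axioms
  have T: "is_functor \<Y> \<X> (ftor_comp \<Y> (radj H) (ladj K))"
    by (rule is_functor_ftor_comp[OF functors(3,2)])
  have "is_nat_trans \<Y> \<X> (ftor_comp \<Y> (ftor_comp \<Y> (radj H) (ladj K)) (ftor_comp \<Y> (radj K) (ladj K)))
      (ftor_comp \<Y> (radj H) (ladj K)) (whisker_counit \<Y> (radj H) K (ladj K))"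
    by (rule is_nat_trans_whisker_counit[OF functors(3) assms(2) functors(2)])
  moreover have "is_nat_trans \<Y> \<X> (ftor_comp \<Y> (ftor_comp \<X> (radj H) (ladj H)) (ftor_comp \<Y> (radj H) (ladj K)))
      (ftor_comp \<Y> (radj H) (ladj K)) (whisker_counit \<Y> (radj H) H (ladj K))"
    by (rule is_nat_trans_whisker_counit[OF functors(3) assms(1) functors(2)])
  ultimately show ?thesis
    unfolding is_bialg_def is_bialg_axioms_def
  proof (intro conjI allI impI, goal_cases)
    case (6 y)
    then show ?case using K.counit_exchange[OF assms(2) functors(2), of "Fo (ladj K) y"] by simp
  next
    case (7 y)
    then show ?case using arg_cong[OF K.triangle_L[of y], of "Fa (radj H)"] by simp
  next
    case (8 y)
    then show ?case using H.counit_exchange[OF assms(1) functors(2), of "Fo (ladj K) y"] by simp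
  next
    case (9 y)
    then show ?case using H.triangle_R[of "Fo (ladj K) y"] by simp
  next
    case (10 y)
    then show ?case using H.counit_exchange[OF assms(2) functors(2), of "Fo (ladj K) y"] by simp
  qed (simp_all add: is_monad_adj_monad[OF assms(1)] is_monad_adj_monad[OF assms(2)] T)
qed

lemma is_morita_Upsilon_obj:
  assumes "is_dadj \<X> \<Y> Z"
  shows "is_morita \<X> \<Y> (Upsilon_obj \<X> \<Y> Z)"
proof -
  interpret is_dadj \<X> \<Y> Z by fact
  note adj = A.is_adjunction_axioms B.is_adjunction_axioms
  note functors = A.L.is_functor_axioms A.R.is_functor_axioms B.L.is_functor_axioms B.R.is_functor_axioms
  \<comment> \<open>The first letter names the counit that is natural, the second the one whose components it is natural at.\<close>
  note xAA = A.counit_exchange[OF adj(1)] and xAB = A.counit_exchange[OF adj(2)]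
    and xBA = B.counit_exchange[OF adj(1)] and xBB = B.counit_exchange[OF adj(2)]
  show ?thesis
    unfolding is_morita_def is_morita_axioms_def Upsilon_obj_eq
  proof (intro conjI allI impI, goal_cases)
    case (5 x)
    then show ?case using xAB[OF functors(2), of "Fo (LA Z) x"] by simp
  next
    case (6 x)
    then show ?case using xBA[OF functors(2), of "Fo (LA Z) x"] by simp
  next
    case (7 x)
    then show ?case using xBA[OF functors(4), of "Fo (LB Z) x"] by simp
  next
    case (8 x)
    then show ?case using xAB[OF functors(4), of "Fo (LB Z) x"] by simp
  next
    case (9 x)
    then show ?case using xBA[OF functors(2), of "Fo (LB Z) x"] by simp
  next
    case (10 x)
    then show ?case using xAB[OF functors(4), of "Fo (LA Z) x"] by simp
  next
    case (11 x)
    then show ?case using xAA[OF functors(4), of "Fo (LB Z) x"] by simp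
  next
    case (12 x)
    then show ?case using xBB[OF functors(2), of "Fo (LA Z) x"] by simp
  qed (simp_all add: is_bialg_adj_bialg[OF adj] is_bialg_adj_bialg[OF adj(2,1)]
      is_nat_trans_whisker_counit[OF functors(1) adj(2) functors(2)]
      is_nat_trans_whisker_counit[OF functors(3) adj(1) functors(4)])
qed

text \<open>
  One half of an arrow of double adjunctions. Both halves, and all eight compatibility equations between
  them, are obtained by instantiating the lemmas about it.
\<close>

locale adjunction_mor = S: is_adjunction \<X> \<Z> H + S': is_adjunction \<X> \<Z>' H' +
  F: is_functor \<Z>' \<Z> F
  for \<X> :: "('xo, 'xm) cat" and \<Z> \<Z>' :: "('zo, 'zm) cat"
    and H H' :: "('xo, 'xm, 'zo, 'zm) adjunction" and F :: "('zo, 'zm, 'zo, 'zm) ftor" +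
  assumes radj_comp: "ftor_comp \<Z>' (radj H) F = radj H'"
begin

lemma radj_F [simp]:
  "z \<in> Obj \<Z>' \<Longrightarrow> Fo (radj H) (Fo F z) = Fo (radj H') z"
  "f \<in> Arr \<Z>' \<Longrightarrow> Fa (radj H) (Fa F f) = Fa (radj H') f"
  by (simp_all flip: radj_comp)

abbreviation "\<alpha> \<equiv> mate \<Z> H H' F"

lemma mate_simps [simp]:
  assumes "x \<in> Obj \<X>"
  shows "\<alpha> x \<in> Arr \<Z>" "Dom \<Z> (\<alpha> x) = Fo (ladj H) x" "Cod \<Z> (\<alpha> x) = Fo F (Fo (ladj H') x)"
  using assms by (simp_all add: mate_def)

text \<open>
  Naturality of \<open>\<epsilon>\<close> at \<open>F (L' f)\<close> and of \<open>\<eta>'\<close> at \<open>f\<close>; the two squares fit together because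
  \<open>R F = R'\<close>.
\<close>

lemma mate_natural:
  assumes "f \<in> Arr \<X>"
  shows "\<alpha> (Cod \<X> f) \<cdot>\<^bsub>\<Z>\<^esub> Fa (ladj H) f = Fa F (Fa (ladj H') f) \<cdot>\<^bsub>\<Z>\<^esub> \<alpha> (Dom \<X> f)"
proof -
  let ?g = "Fa F (Fa (ladj H') f)"
  have "Fa F (Fa (ladj H') f) \<cdot>\<^bsub>\<Z>\<^esub> \<alpha> (Dom \<X> f) =
      (eps H (Cod \<Z> ?g) \<cdot>\<^bsub>\<Z>\<^esub> Fa (ladj H) (Fa (radj H) ?g)) \<cdot>\<^bsub>\<Z>\<^esub> Fa (ladj H) (eta H' (Dom \<X> f))"
    using assms by (subst S.eps_natural) (simp_all add: mate_def)
  also have "\<dots> = eps H (Cod \<Z> ?g) \<cdot>\<^bsub>\<Z>\<^esub> Fa (ladj H) (Fa (radj H') (Fa (ladj H') f) \<cdot>\<^bsub>\<X>\<^esub> eta H' (Dom \<X> f))"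
    using assms by simp
  also have "\<dots> = \<alpha> (Cod \<X> f) \<cdot>\<^bsub>\<Z>\<^esub> Fa (ladj H) f"
    unfolding S'.eta_natural[OF assms, symmetric] using assms by (simp add: mate_def)
  finally show ?thesis by simp
qed

text \<open>
  The property that characterises the mate: \<open>F\<close> carries one counit to the other up to \<open>\<alpha>\<close>. By naturality
  of \<open>\<epsilon>\<close> at \<open>F (\<epsilon>' z)\<close> it reduces to a triangle identity of the primed adjunction.
\<close>

lemma counit_mate:
  assumes "z \<in> Obj \<Z>'"
  shows "Fa F (eps H' z) \<cdot>\<^bsub>\<Z>\<^esub> \<alpha> (Fo (radj H') z) = eps H (Fo F z)"
proof -
  let ?g = "Fa F (eps H' z)"
  have "?g \<cdot>\<^bsub>\<Z>\<^esub> \<alpha> (Fo (radj H') z) =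
      (eps H (Cod \<Z> ?g) \<cdot>\<^bsub>\<Z>\<^esub> Fa (ladj H) (Fa (radj H) ?g)) \<cdot>\<^bsub>\<Z>\<^esub> Fa (ladj H) (eta H' (Fo (radj H') z))"
    using assms by (subst S.eps_natural) (simp_all add: mate_def)
  also have "\<dots> = eps H (Fo F z) \<cdot>\<^bsub>\<Z>\<^esub> Fa (ladj H) (Fa (radj H') (eps H' z) \<cdot>\<^bsub>\<X>\<^esub> eta H' (Fo (radj H') z))"
    using assms by simp
  also have "\<dots> = eps H (Fo F z)"
    using assms by (subst S'.triangle_R) simp_all
  finally show ?thesis .
qed

lemma mate_unit:
  assumes "x \<in> Obj \<X>"
  shows "Fa (radj H) (\<alpha> x) \<cdot>\<^bsub>\<X>\<^esub> eta H x = eta H' x"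
proof -
  have "Fa (radj H) (\<alpha> x) \<cdot>\<^bsub>\<X>\<^esub> eta H x =
      Fa (radj H) (eps H (Fo F (Fo (ladj H') x))) \<cdot>\<^bsub>\<X>\<^esub> Fa (radj H) (Fa (ladj H) (eta H' x)) \<cdot>\<^bsub>\<X>\<^esub> eta H x"
    using assms by (simp add: mate_def)
  also have "Fa (radj H) (Fa (ladj H) (eta H' x)) \<cdot>\<^bsub>\<X>\<^esub> eta H x =
      eta H (Fo (radj H') (Fo (ladj H') x)) \<cdot>\<^bsub>\<X>\<^esub> eta H' x"
    using S.eta_natural[of "eta H' x"] assms by simp
  also have "Fa (radj H) (eps H (Fo F (Fo (ladj H') x))) \<cdot>\<^bsub>\<X>\<^esub> \<dots> =
      (Fa (radj H) (eps H (Fo F (Fo (ladj H') x))) \<cdot>\<^bsub>\<X>\<^esub> eta H (Fo (radj H) (Fo F (Fo (ladj H') x)))) \<cdot>\<^bsub>\<X>\<^esub> eta H' x"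
    using assms by simp
  also have "\<dots> = eta H' x"
    using assms by (subst S.triangle_R) simp_all
  finally show ?thesis .
qed

lemma is_nat_trans_mate:
  assumes "is_functor \<Z> \<W> R" "is_functor \<Z>' \<W> R'" "ftor_comp \<Z>' R F = R'"
  shows "is_nat_trans \<X> \<W> (ftor_comp \<X> R (ladj H)) (ftor_comp \<X> R' (ladj H')) (\<lambda>x\<in>Obj \<X>. Fa R (\<alpha> x))"
proof -
  interpret R: is_functor \<Z> \<W> R by fact
  have [simp]: "Fo R' z = Fo R (Fo F z)" if "z \<in> Obj \<Z>'" for z
    using that by (simp flip: assms(3))
  have [simp]: "Fa R' f = Fa R (Fa F f)" if "f \<in> Arr \<Z>'" for f
    using that by (simp flip: assms(3))
  show ?thesis
  proof (rule is_nat_transI)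
    fix f assume "f \<in> Arr \<X>"
    then show "(\<lambda>x\<in>Obj \<X>. Fa R (\<alpha> x)) (Cod \<X> f) \<cdot>\<^bsub>\<W>\<^esub> Fa (ftor_comp \<X> R (ladj H)) f =
        Fa (ftor_comp \<X> R' (ladj H')) f \<cdot>\<^bsub>\<W>\<^esub> (\<lambda>x\<in>Obj \<X>. Fa R (\<alpha> x)) (Dom \<X> f)"
      using arg_cong[OF mate_natural[of f], of "Fa R"] by simp
  qed (auto intro: is_functor_ftor_comp assms S.L.is_functor_axioms S'.L.is_functor_axioms)
qed

end

text \<open>
  All eight compatibility equations for the image of an arrow: the target functor \<open>R\<close> and the two
  adjunctions \<open>H\<close>, \<open>K\<close> range over the two halves of a double adjunction. Before \<open>R\<close> is applied, the
  equation is the naturality of the counit of \<open>K\<close> at a component of the mate for \<open>H\<close>, rewritten by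
  \<open>counit_mate\<close>.
\<close>

lemma mate_square:
  assumes "adjunction_mor \<X> \<Z> \<Z>' H H' F" "adjunction_mor \<Y> \<Z> \<Z>' K K' F"
    and "is_functor \<Z> \<W> R" "ftor_comp \<Z>' R F = R'" "x \<in> Obj \<X>"
  shows "Fa R (mate \<Z> H H' F x) \<cdot>\<^bsub>\<W>\<^esub> Fa R (eps K (Fo (ladj H) x)) =
    Fa R' (eps K' (Fo (ladj H') x)) \<cdot>\<^bsub>\<W>\<^esub>
      (Fa R (mate \<Z> K K' F (Fo (radj K') (Fo (ladj H') x))) \<cdot>\<^bsub>\<W>\<^esub>
        Fa R (Fa (ladj K) (Fa (radj K) (mate \<Z> H H' F x))))"
proof -
  interpret H: adjunction_mor \<X> \<Z> \<Z>' H H' F by fact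
  interpret K: adjunction_mor \<Y> \<Z> \<Z>' K K' F by fact
  interpret R: is_functor \<Z> \<W> R by fact
  let ?z = "Fo (ladj H') x" and ?a = "mate \<Z> H H' F x"
  have R': "Fa R' f = Fa R (Fa F f)" if "f \<in> Arr \<Z>'" for f
    using that by (simp flip: assms(4))
  have "?a \<cdot>\<^bsub>\<Z>\<^esub> eps K (Fo (ladj H) x) = eps K (Fo F ?z) \<cdot>\<^bsub>\<Z>\<^esub> Fa (ladj K) (Fa (radj K) ?a)"
    using K.S.eps_natural[of ?a] \<open>x \<in> Obj \<X>\<close> by simp
  also have "eps K (Fo F ?z) = Fa F (eps K' ?z) \<cdot>\<^bsub>\<Z>\<^esub> mate \<Z> K K' F (Fo (radj K') ?z)"
    using \<open>x \<in> Obj \<X>\<close> by (simp add: K.counit_mate)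
  finally show ?thesis
    using arg_cong[of _ _ "Fa R"] \<open>x \<in> Obj \<X>\<close> by (simp add: R' flip: R.Fa_Comp)
qed

lemma is_dadj_mor_adjunction_mors:
  assumes "is_dadj_mor \<X> \<Y> Z Z' F"
  shows "adjunction_mor \<X> (apex Z) (apex Z') (adjA Z) (adjA Z') F"
    and "adjunction_mor \<Y> (apex Z) (apex Z') (adjB Z) (adjB Z') F"
proof -
  interpret is_dadj_mor \<X> \<Y> Z Z' F by fact
  show "adjunction_mor \<X> (apex Z) (apex Z') (adjA Z) (adjA Z') F"
    by unfold_locales (rule RA_comp)
  show "adjunction_mor \<Y> (apex Z) (apex Z') (adjB Z) (adjB Z') F"
    by unfold_locales (rule RB_comp)
qed

lemma is_morita_mor_Upsilon_map:
  assumes "is_dadj_mor \<X> \<Y> (Src F) (Tgt F) (Map F)"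
  shows "is_morita_mor \<X> \<Y> (Upsilon_obj \<X> \<Y> (Src F)) (Upsilon_obj \<X> \<Y> (Tgt F)) (Upsilon_map \<X> \<Y> F)"
proof -
  interpret is_dadj_mor \<X> \<Y> "Src F" "Tgt F" "Map F" by fact
  note A = is_dadj_mor_adjunction_mors(1)[OF assms] and B = is_dadj_mor_adjunction_mors(2)[OF assms]
  interpret A: adjunction_mor \<X> "apex (Src F)" "apex (Tgt F)" "adjA (Src F)" "adjA (Tgt F)" "Map F" by (rule A)
  interpret B: adjunction_mor \<Y> "apex (Src F)" "apex (Tgt F)" "adjB (Src F)" "adjB (Tgt F)" "Map F" by (rule B)
  note RA = S.A.R.is_functor_axioms and RA' = S'.A.R.is_functor_axioms
    and RB = S.B.R.is_functor_axioms and RB' = S'.B.R.is_functor_axioms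
  note toA = RA RA_comp and toB = RB RB_comp
  show ?thesis
    by (rule is_morita_morI)
      (simp_all add: S.is_dadj_axioms S'.is_dadj_axioms is_morita_Upsilon_obj,
        simp_all add: Upsilon_obj_eq Upsilon_map_def Let_def
        A.is_nat_trans_mate[OF RA RA' RA_comp] A.is_nat_trans_mate[OF RB RB' RB_comp]
        B.is_nat_trans_mate[OF RA RA' RA_comp] B.is_nat_trans_mate[OF RB RB' RB_comp]
        A.mate_unit B.mate_unit
        mate_square[OF A A toA] mate_square[OF A A toB] mate_square[OF A B toA] mate_square[OF A B toB]
        mate_square[OF B A toA] mate_square[OF B A toB] mate_square[OF B B toA] mate_square[OF B B toB])
qed

lemma mate_Ide:
  assumes "is_adjunction \<X> \<Z> H" "x \<in> Obj \<X>"
  shows "mate \<Z> H H (ftor_id \<Z>) x = Ide \<Z> (Fo (ladj H) x)"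
proof -
  interpret is_adjunction \<X> \<Z> H by fact
  show ?thesis using \<open>x \<in> Obj \<X>\<close> by (simp add: mate_def triangle_L)
qed

text \<open>
  Only the second mate has to be unfolded: the first one is moved past \<open>L' (\<eta>'' x)\<close> by its naturality and
  then absorbed by the counit \<open>\<epsilon>'\<close> through \<open>counit_mate\<close>.
\<close>

lemma mate_Comp:
  assumes "adjunction_mor \<X> \<Z> \<Z>' H H' F" "adjunction_mor \<X> \<Z>' \<Z>'' H' H'' G" "x \<in> Obj \<X>"
  shows "mate \<Z> H H'' (ftor_comp \<Z>'' F G) x = Fa F (mate \<Z>' H' H'' G x) \<cdot>\<^bsub>\<Z>\<^esub> mate \<Z> H H' F x"
proof -
  interpret F: adjunction_mor \<X> \<Z> \<Z>' H H' F by fact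
  interpret G: adjunction_mor \<X> \<Z>' \<Z>'' H' H'' G by fact
  let ?z = "Fo G (Fo (ladj H'') x)" and ?u = "eta H'' x"
  have "Fa F (mate \<Z>' H' H'' G x) \<cdot>\<^bsub>\<Z>\<^esub> mate \<Z> H H' F x =
      Fa F (eps H' ?z) \<cdot>\<^bsub>\<Z>\<^esub> Fa F (Fa (ladj H') ?u) \<cdot>\<^bsub>\<Z>\<^esub> mate \<Z> H H' F x"
    using assms(3) by (simp add: mate_def[of \<Z>'])
  also have "Fa F (Fa (ladj H') ?u) \<cdot>\<^bsub>\<Z>\<^esub> mate \<Z> H H' F x =
      mate \<Z> H H' F (Fo (radj H') ?z) \<cdot>\<^bsub>\<Z>\<^esub> Fa (ladj H) ?u"
    using F.mate_natural[of ?u] assms(3) by simp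
  also have "Fa F (eps H' ?z) \<cdot>\<^bsub>\<Z>\<^esub> \<dots> =
      (Fa F (eps H' ?z) \<cdot>\<^bsub>\<Z>\<^esub> mate \<Z> H H' F (Fo (radj H') ?z)) \<cdot>\<^bsub>\<Z>\<^esub> Fa (ladj H) ?u"
    using assms(3) by simp
  also have "\<dots> = eps H (Fo F ?z) \<cdot>\<^bsub>\<Z>\<^esub> Fa (ladj H) ?u"
    using assms(3) by (subst F.counit_mate) simp_all
  finally show ?thesis using assms(3) by (simp add: mate_def)
qed

lemma Upsilon_map_Ide:
  assumes "is_dadj \<X> \<Y> Z"
  shows "Upsilon_map \<X> \<Y> (Ide (Adj \<X> \<Y>) Z) = Map (Ide (Mor \<X> \<Y>) (Upsilon_obj \<X> \<Y> Z))"
proof -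
  interpret is_dadj \<X> \<Y> Z by fact
  show ?thesis
    by (simp add: Upsilon_map_def Upsilon_obj_eq Mor_def Let_def mate_Ide[OF A.is_adjunction_axioms]
        mate_Ide[OF B.is_adjunction_axioms] cong: restrict_cong)
qed

lemma Upsilon_map_Comp:
  fixes F G :: "('xo, 'xm, 'yo, 'ym, 'zo, 'zm) dadj_arr"
  assumes "is_dadj_mor \<X> \<Y> (Src F) (Tgt F) (Map F)" "is_dadj_mor \<X> \<Y> (Src G) (Tgt G) (Map G)"
    and "Src G = Tgt F"
  shows "Upsilon_map \<X> \<Y> (G \<cdot>\<^bsub>Adj \<X> \<Y>\<^esub> F) =
    Map (\<lparr>Src = Upsilon_obj \<X> \<Y> (Src G), Tgt = Upsilon_obj \<X> \<Y> (Tgt G), Map = Upsilon_map \<X> \<Y> G\<rparr>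
      \<cdot>\<^bsub>Mor \<X> \<Y>\<^esub>
      \<lparr>Src = Upsilon_obj \<X> \<Y> (Src F), Tgt = Upsilon_obj \<X> \<Y> (Tgt F), Map = Upsilon_map \<X> \<Y> F\<rparr>)"
proof -
  have G: "is_dadj_mor \<X> \<Y> (Tgt F) (Tgt G) (Map G)" using assms(2,3) by simp
  interpret F: is_dadj_mor \<X> \<Y> "Src F" "Tgt F" "Map F" by fact
  interpret G: is_dadj_mor \<X> \<Y> "Tgt F" "Tgt G" "Map G" by (rule G)
  interpret FA: adjunction_mor \<X> "apex (Src F)" "apex (Tgt F)" "adjA (Src F)" "adjA (Tgt F)" "Map F"
    by (rule is_dadj_mor_adjunction_mors[OF assms(1)])
  interpret FB: adjunction_mor \<Y> "apex (Src F)" "apex (Tgt F)" "adjB (Src F)" "adjB (Tgt F)" "Map F"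
    by (rule is_dadj_mor_adjunction_mors[OF assms(1)])
  interpret GA: adjunction_mor \<X> "apex (Tgt F)" "apex (Tgt G)" "adjA (Tgt F)" "adjA (Tgt G)" "Map G"
    by (rule is_dadj_mor_adjunction_mors[OF G])
  interpret GB: adjunction_mor \<Y> "apex (Tgt F)" "apex (Tgt G)" "adjB (Tgt F)" "adjB (Tgt G)" "Map G"
    by (rule is_dadj_mor_adjunction_mors[OF G])
  show ?thesis
    by (simp add: Upsilon_map_def Mor_def Let_def \<open>Src G = Tgt F\<close>
        mate_Comp[OF FA.adjunction_mor_axioms GA.adjunction_mor_axioms]
        mate_Comp[OF FB.adjunction_mor_axioms GB.adjunction_mor_axioms] cong: restrict_cong)
qed

lemma is_functor_Upsilon: "is_functor (Adj \<X> \<Y>) (Mor \<X> \<Y>) (Upsilon \<X> \<Y>)"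
proof (rule is_functorI, goal_cases)
  case (7 Z)
  then show ?case
    using Upsilon_map_Ide[of \<X> \<Y> Z]
    by (simp add: Upsilon_def is_dadj_mor_Ide arrow_eqI)
next
  case (8 F G)
  then show ?case
    using Upsilon_map_Comp[of \<X> \<Y> F G] 
    by (simp add: Upsilon_def is_dadj_mor_Comp arrow_eqI)
qed (auto simp: category_Adj category_Mor Upsilon_def is_morita_Upsilon_obj is_morita_mor_Upsilon_map
    dest: is_dadj_mor.axioms)


section \<open>The Eilenberg-Moore category of a Morita context\<close>

lemma EM_simps [simp]:
  "Obj (EM \<X> \<Y> T) = {E. is_em_obj \<X> \<Y> T E}"
  "Dom (EM \<X> \<Y> T) = Src" "Cod (EM \<X> \<Y> T) = Tgt"
  "Ide (EM \<X> \<Y> T) E = \<lparr>Src = E, Tgt = E, Map = (Ide \<X> (emX E), Ide \<Y> (emY E))\<rparr>"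
  "k \<cdot>\<^bsub>EM \<X> \<Y> T\<^esub> h = \<lparr>Src = Src h, Tgt = Tgt k,
    Map = (fst (Map k) \<cdot>\<^bsub>\<X>\<^esub> fst (Map h), snd (Map k) \<cdot>\<^bsub>\<Y>\<^esub> snd (Map h))\<rparr>"
  by (simp_all add: EM_def)

lemma Arr_EM:
  "h \<in> Arr (EM \<X> \<Y> T) \<longleftrightarrow> is_em_obj \<X> \<Y> T (Src h) \<and> is_em_obj \<X> \<Y> T (Tgt h) \<and>
    is_em_mor \<X> \<Y> T (Src h) (Tgt h) (Map h)"
  by (simp add: EM_def)

lemma GA_obj_simps [simp]:
  "emX (GA_obj T x) = Fo (fA T) x" "actX (GA_obj T x) = mul (mnA T) x"
  "emY (GA_obj T x) = Fo (fTh T) x" "actY (GA_obj T x) = lamh T x"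
  "emv (GA_obj T x) = ev T x" "emw (GA_obj T x) = rhoh T x"
  by (simp_all add: GA_obj_def)

lemma GB_obj_simps [simp]:
  "emX (GB_obj T y) = Fo (fT T) y" "actX (GB_obj T y) = lam T y"
  "emY (GB_obj T y) = Fo (fB T) y" "actY (GB_obj T y) = mul (mnB T) y"
  "emv (GB_obj T y) = rho T y" "emw (GB_obj T y) = evh T y"
  by (simp_all add: GB_obj_def)

context is_morita
begin

abbreviation "\<E> \<equiv> EM \<X> \<Y> T"

lemma em_obj_simps [simp]:
  assumes "is_em_obj \<X> \<Y> T E"
  shows "emX E \<in> Obj \<X>" "emY E \<in> Obj \<Y>"
    "actX E \<in> Arr \<X>" "Dom \<X> (actX E) = Fo (fA T) (emX E)" "Cod \<X> (actX E) = emX E"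
    "actY E \<in> Arr \<Y>" "Dom \<Y> (actY E) = Fo (fB T) (emY E)" "Cod \<Y> (actY E) = emY E"
    "emv E \<in> Arr \<X>" "Dom \<X> (emv E) = Fo (fT T) (emY E)" "Cod \<X> (emv E) = emX E"
    "emw E \<in> Arr \<Y>" "Dom \<Y> (emw E) = Fo (fTh T) (emX E)" "Cod \<Y> (emw E) = emY E"
  using assms unfolding is_em_obj_def is_algebra_def mem_hom by blast+

text \<open>
  The eight laws are oriented as \<open>c \<circ> \<alpha> = d \<circ> G e\<close> with \<open>c\<close>, \<open>d\<close>, \<open>e\<close> structure maps of the
  object and \<open>\<alpha>\<close> a structure map of the context, which is the shape needed for pasting.
\<close>

lemma em_obj_laws:
  assumes "is_em_obj \<X> \<Y> T E"
  shows "actX E \<cdot>\<^bsub>\<X>\<^esub> mul (mnA T) (emX E) = actX E \<cdot>\<^bsub>\<X>\<^esub> Fa (fA T) (actX E)"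
    and "actY E \<cdot>\<^bsub>\<Y>\<^esub> mul (mnB T) (emY E) = actY E \<cdot>\<^bsub>\<Y>\<^esub> Fa (fB T) (actY E)"
    and "emv E \<cdot>\<^bsub>\<X>\<^esub> lam T (emY E) = actX E \<cdot>\<^bsub>\<X>\<^esub> Fa (fA T) (emv E)"
    and "emw E \<cdot>\<^bsub>\<Y>\<^esub> lamh T (emX E) = actY E \<cdot>\<^bsub>\<Y>\<^esub> Fa (fB T) (emw E)"
    and "actX E \<cdot>\<^bsub>\<X>\<^esub> ev T (emX E) = emv E \<cdot>\<^bsub>\<X>\<^esub> Fa (fT T) (emw E)"
    and "actY E \<cdot>\<^bsub>\<Y>\<^esub> evh T (emY E) = emw E \<cdot>\<^bsub>\<Y>\<^esub> Fa (fTh T) (emv E)"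
    and "emw E \<cdot>\<^bsub>\<Y>\<^esub> rhoh T (emX E) = emw E \<cdot>\<^bsub>\<Y>\<^esub> Fa (fTh T) (actX E)"
    and "emv E \<cdot>\<^bsub>\<X>\<^esub> rho T (emY E) = emv E \<cdot>\<^bsub>\<X>\<^esub> Fa (fT T) (actY E)"
  using assms unfolding is_em_obj_def is_algebra_def
  by metis+

lemma em_obj_unit:
  assumes "is_em_obj \<X> \<Y> T E"
  shows "actX E \<cdot>\<^bsub>\<X>\<^esub> unit (mnA T) (emX E) = Ide \<X> (emX E)"
    and "actY E \<cdot>\<^bsub>\<Y>\<^esub> unit (mnB T) (emY E) = Ide \<Y> (emY E)"
  using assms unfolding is_em_obj_def is_algebra_def
  by blast+

lemma em_arr_simps [simp]:
  assumes "h \<in> Arr \<E>"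
  shows "is_em_obj \<X> \<Y> T (Src h)" "is_em_obj \<X> \<Y> T (Tgt h)"
    "fst (Map h) \<in> Arr \<X>" "Dom \<X> (fst (Map h)) = emX (Src h)" "Cod \<X> (fst (Map h)) = emX (Tgt h)"
    "snd (Map h) \<in> Arr \<Y>" "Dom \<Y> (snd (Map h)) = emY (Src h)" "Cod \<Y> (snd (Map h)) = emY (Tgt h)"
  using assms unfolding Arr_EM is_em_mor_def is_algebra_mor_def mem_hom by blast+

lemma em_arr_laws:
  assumes "h \<in> Arr \<E>"
  shows "fst (Map h) \<cdot>\<^bsub>\<X>\<^esub> actX (Src h) = actX (Tgt h) \<cdot>\<^bsub>\<X>\<^esub> Fa (fA T) (fst (Map h))"
    and "snd (Map h) \<cdot>\<^bsub>\<Y>\<^esub> actY (Src h) = actY (Tgt h) \<cdot>\<^bsub>\<Y>\<^esub> Fa (fB T) (snd (Map h))"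
    and "fst (Map h) \<cdot>\<^bsub>\<X>\<^esub> emv (Src h) = emv (Tgt h) \<cdot>\<^bsub>\<X>\<^esub> Fa (fT T) (snd (Map h))"
    and "snd (Map h) \<cdot>\<^bsub>\<Y>\<^esub> emw (Src h) = emw (Tgt h) \<cdot>\<^bsub>\<Y>\<^esub> Fa (fTh T) (fst (Map h))"
  using assms unfolding Arr_EM is_em_mor_def is_algebra_mor_def by blast+

lemma em_arrI:
  assumes "is_em_obj \<X> \<Y> T (Src h)" "is_em_obj \<X> \<Y> T (Tgt h)"
    "fst (Map h) \<in> Arr \<X>" "Dom \<X> (fst (Map h)) = emX (Src h)" "Cod \<X> (fst (Map h)) = emX (Tgt h)"
    "snd (Map h) \<in> Arr \<Y>" "Dom \<Y> (snd (Map h)) = emY (Src h)" "Cod \<Y> (snd (Map h)) = emY (Tgt h)"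
    "fst (Map h) \<cdot>\<^bsub>\<X>\<^esub> actX (Src h) = actX (Tgt h) \<cdot>\<^bsub>\<X>\<^esub> Fa (fA T) (fst (Map h))"
    "snd (Map h) \<cdot>\<^bsub>\<Y>\<^esub> actY (Src h) = actY (Tgt h) \<cdot>\<^bsub>\<Y>\<^esub> Fa (fB T) (snd (Map h))"
    "fst (Map h) \<cdot>\<^bsub>\<X>\<^esub> emv (Src h) = emv (Tgt h) \<cdot>\<^bsub>\<X>\<^esub> Fa (fT T) (snd (Map h))"
    "snd (Map h) \<cdot>\<^bsub>\<Y>\<^esub> emw (Src h) = emw (Tgt h) \<cdot>\<^bsub>\<Y>\<^esub> Fa (fTh T) (fst (Map h))"
  shows "h \<in> Arr \<E>"
  using assms unfolding Arr_EM is_em_mor_def is_algebra_mor_def mem_hom by blast+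

lemma category_EM: "category \<E>"
proof (rule categoryI, goal_cases)
  case (6 h k)
  have [simp]: "Src k = Tgt h" using 6 by simp
  note K = em_arr_laws[OF 6(2), simplified]
  have "k \<cdot>\<^bsub>\<E>\<^esub> h \<in> Arr \<E>"
    using 6 T.A.mul.G.square_stack[OF em_arr_laws(1)[OF 6(1)] K(1)]
      T.B.mul.G.square_stack[OF em_arr_laws(2)[OF 6(1)] K(2)]
      T.T.square_stack[OF em_arr_laws(3)[OF 6(1)] K(3)]
      Th.T.square_stack[OF em_arr_laws(4)[OF 6(1)] K(4)]
    by (intro em_arrI) simp_all
  then show ?case by simp
qed (auto intro!: arrow_eqI prod_eqI em_arrI)

lemma is_em_obj_GA: "x \<in> Obj \<X> \<Longrightarrow> is_em_obj \<X> \<Y> T (GA_obj T x)"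
  by (simp add: is_em_obj_def is_algebra_def mem_hom T.A.mul_assoc T.A.unit_left
      Th.lact_mul Th.lact_unit Th.ract_lact Th.ract_mul ev_lam ev_rhoh lamh_evh ev_rho)

lemma is_em_obj_GB: "y \<in> Obj \<Y> \<Longrightarrow> is_em_obj \<X> \<Y> T (GB_obj T y)"
  by (simp add: is_em_obj_def is_algebra_def mem_hom T.B.mul_assoc T.B.unit_left
      T.lact_mul T.lact_unit T.ract_lact T.ract_mul evh_lamh evh_rho rho_evh evh_lam)

lemma is_functor_GA: "is_functor \<X> \<E> (ladj (em_adjA \<X> \<Y> T))"
proof (rule is_functorI, goal_cases)
  case (6 f)
  then have "Fa (ladj (em_adjA \<X> \<Y> T)) f \<in> Arr \<E>"
    using T.A.mul.natural[of f] Th.lact.natural[of f] Th.ract.natural[of f] ev.natural[of f]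
    by (intro em_arrI) (simp_all add: em_adjA_def is_em_obj_GA)
  then show ?case using 6 by (simp add: em_adjA_def)
qed (auto simp: T.A.category_axioms category_EM is_em_obj_GA em_adjA_def)

lemma is_functor_GB: "is_functor \<Y> \<E> (ladj (em_adjB \<X> \<Y> T))"
proof (rule is_functorI, goal_cases)
  case (6 f)
  then have "Fa (ladj (em_adjB \<X> \<Y> T)) f \<in> Arr \<E>"
    using T.B.mul.natural[of f] T.lact.natural[of f] T.ract.natural[of f] evh.natural[of f]
    by (intro em_arrI) (simp_all add: em_adjB_def is_em_obj_GB)
  then show ?case using 6 by (simp add: em_adjB_def)
qed (auto simp: T.B.category_axioms category_EM is_em_obj_GB em_adjB_def)

lemma is_functor_UA: "is_functor \<E> \<X> (radj (em_adjA \<X> \<Y> T))"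
proof -
  interpret E: category \<E> by (rule category_EM)
  show ?thesis
  proof (rule is_functorI, goal_cases)
    case 7
    with E.Ide_simps show ?case by (simp add: em_adjA_def)
  next
    case (8 f g)
    with E.Comp_simps[OF this] show ?case by (simp add: em_adjA_def)
  qed (auto simp: T.A.category_axioms category_EM em_adjA_def)
qed

lemma is_functor_UB: "is_functor \<E> \<Y> (radj (em_adjB \<X> \<Y> T))"
proof -
  interpret E: category \<E> by (rule category_EM)
  show ?thesis
  proof (rule is_functorI, goal_cases)
    case 7
    with E.Ide_simps show ?case by (simp add: em_adjB_def)
  next
    case (8 f g)
    with E.Comp_simps[OF this] show ?case by (simp add: em_adjB_def)
  qed (auto simp: T.B.category_axioms category_EM em_adjB_def)
qed

lemma UA_GA: "ftor_comp \<X> (radj (em_adjA \<X> \<Y> T)) (ladj (em_adjA \<X> \<Y> T)) = fA T"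
proof -
  interpret G: is_functor \<X> \<E> "ladj (em_adjA \<X> \<Y> T)" by (rule is_functor_GA)
  show ?thesis
  proof (rule ftor_eqI[OF is_functor_ftor_comp[OF is_functor_GA is_functor_UA] T.A.mul.G.is_functor_axioms])
    fix f assume "f \<in> Arr \<X>"
    with G.Fa_simps(1)[OF this] show "Fa (ftor_comp \<X> (radj (em_adjA \<X> \<Y> T)) (ladj (em_adjA \<X> \<Y> T))) f = Fa (fA T) f"
      by (simp add: em_adjA_def)
  qed (simp add: em_adjA_def is_em_obj_GA)
qed

text \<open>
  The unit is that of the monad, since \<open>U\<^sub>A G\<^sub>A = A\<close>. The counit \<open>(r, w)\<close> at an object is a morphism by
  four of the laws of that object and natural by the laws of a morphism. The triangle identities are the
  unit laws of the monad, of the right action on \<open>T\<close>-hat and of the algebra.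
\<close>

lemma is_adjunction_em_adjA: "is_adjunction \<X> \<E> (em_adjA \<X> \<Y> T)"
proof -
  interpret E: category \<E> by (rule category_EM)
  interpret G: is_functor \<X> \<E> "ladj (em_adjA \<X> \<Y> T)" by (rule is_functor_GA)
  interpret U: is_functor \<E> \<X> "radj (em_adjA \<X> \<Y> T)" by (rule is_functor_UA)
  have eps_Arr: "eps (em_adjA \<X> \<Y> T) E \<in> Arr \<E>" if "is_em_obj \<X> \<Y> T E" for E
    using that em_obj_laws[OF that] by (intro em_arrI) (simp_all add: em_adjA_def is_em_obj_GA)
  have "is_nat_trans \<E> \<E> (ftor_comp \<E> (ladj (em_adjA \<X> \<Y> T)) (radj (em_adjA \<X> \<Y> T)))
      (ftor_id \<E>) (eps (em_adjA \<X> \<Y> T))"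
  proof (rule is_nat_transI)
    fix E assume "E \<in> Obj \<E>"
    with eps_Arr[of E] show "eps (em_adjA \<X> \<Y> T) E \<in> Arr \<E> \<and>
      Dom \<E> (eps (em_adjA \<X> \<Y> T) E) = Fo (ftor_comp \<E> (ladj (em_adjA \<X> \<Y> T)) (radj (em_adjA \<X> \<Y> T))) E \<and>
      Cod \<E> (eps (em_adjA \<X> \<Y> T) E) = Fo (ftor_id \<E>) E"
      by (simp add: em_adjA_def)
  next
    fix h assume h: "h \<in> Arr \<E>"
    then show "eps (em_adjA \<X> \<Y> T) (Cod \<E> h) \<cdot>\<^bsub>\<E>\<^esub>
        Fa (ftor_comp \<E> (ladj (em_adjA \<X> \<Y> T)) (radj (em_adjA \<X> \<Y> T))) h =
      Fa (ftor_id \<E>) h \<cdot>\<^bsub>\<E>\<^esub> eps (em_adjA \<X> \<Y> T) (Dom \<E> h)"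
      using em_arr_laws[OF h] by (simp add: em_adjA_def)
  qed (simp_all add: is_functor_ftor_comp[OF is_functor_UA is_functor_GA] is_functor_ftor_id category_EM,
      simp add: em_adjA_def)
  moreover have "is_nat_trans \<X> \<X> (ftor_id \<X>)
      (ftor_comp \<X> (radj (em_adjA \<X> \<Y> T)) (ladj (em_adjA \<X> \<Y> T))) (eta (em_adjA \<X> \<Y> T))"
    unfolding UA_GA using T.A.unit.is_nat_trans_axioms by (simp add: em_adjA_def)
  ultimately show ?thesis
    unfolding is_adjunction_def is_adjunction_axioms_def
  proof (intro conjI allI impI, goal_cases)
    case (5 x)
    then show ?case
      by (simp add: em_adjA_def is_em_obj_GA T.A.unit_right Th.ract_unit)
  next
    case (6 E)
    then show ?case
      using eps_Arr[of E] em_obj_unit[of E] by (simp add: em_adjA_def)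
  qed (simp_all add: is_functor_GA is_functor_UA)
qed

lemma UB_GB: "ftor_comp \<Y> (radj (em_adjB \<X> \<Y> T)) (ladj (em_adjB \<X> \<Y> T)) = fB T"
proof -
  interpret G: is_functor \<Y> \<E> "ladj (em_adjB \<X> \<Y> T)" by (rule is_functor_GB)
  show ?thesis
  proof (rule ftor_eqI[OF is_functor_ftor_comp[OF is_functor_GB is_functor_UB] T.B.mul.G.is_functor_axioms])
    fix f assume "f \<in> Arr \<Y>"
    with G.Fa_simps(1)[OF this] show "Fa (ftor_comp \<Y> (radj (em_adjB \<X> \<Y> T)) (ladj (em_adjB \<X> \<Y> T))) f = Fa (fB T) f"
      by (simp add: em_adjB_def)
  qed (simp add: em_adjB_def is_em_obj_GB)
qed

text \<open>
  The same argument with the two sides exchanged: the counit is now \<open>(v, s)\<close>, and the remaining four laws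
  of an object say that it is a morphism.
\<close>

lemma is_adjunction_em_adjB: "is_adjunction \<Y> \<E> (em_adjB \<X> \<Y> T)"
proof -
  interpret E: category \<E> by (rule category_EM)
  interpret G: is_functor \<Y> \<E> "ladj (em_adjB \<X> \<Y> T)" by (rule is_functor_GB)
  interpret U: is_functor \<E> \<Y> "radj (em_adjB \<X> \<Y> T)" by (rule is_functor_UB)
  have eps_Arr: "eps (em_adjB \<X> \<Y> T) E \<in> Arr \<E>" if "is_em_obj \<X> \<Y> T E" for E
    using that em_obj_laws[OF that] by (intro em_arrI) (simp_all add: em_adjB_def is_em_obj_GB)
  have "is_nat_trans \<E> \<E> (ftor_comp \<E> (ladj (em_adjB \<X> \<Y> T)) (radj (em_adjB \<X> \<Y> T)))
      (ftor_id \<E>) (eps (em_adjB \<X> \<Y> T))"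
  proof (rule is_nat_transI)
    fix E assume "E \<in> Obj \<E>"
    with eps_Arr[of E] show "eps (em_adjB \<X> \<Y> T) E \<in> Arr \<E> \<and>
      Dom \<E> (eps (em_adjB \<X> \<Y> T) E) = Fo (ftor_comp \<E> (ladj (em_adjB \<X> \<Y> T)) (radj (em_adjB \<X> \<Y> T))) E \<and>
      Cod \<E> (eps (em_adjB \<X> \<Y> T) E) = Fo (ftor_id \<E>) E"
      by (simp add: em_adjB_def)
  next
    fix h assume h: "h \<in> Arr \<E>"
    then show "eps (em_adjB \<X> \<Y> T) (Cod \<E> h) \<cdot>\<^bsub>\<E>\<^esub>
        Fa (ftor_comp \<E> (ladj (em_adjB \<X> \<Y> T)) (radj (em_adjB \<X> \<Y> T))) h =
      Fa (ftor_id \<E>) h \<cdot>\<^bsub>\<E>\<^esub> eps (em_adjB \<X> \<Y> T) (Dom \<E> h)"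
      using em_arr_laws[OF h] by (simp add: em_adjB_def)
  qed (simp_all add: is_functor_ftor_comp[OF is_functor_UB is_functor_GB] is_functor_ftor_id category_EM,
      simp add: em_adjB_def)
  moreover have "is_nat_trans \<Y> \<Y> (ftor_id \<Y>)
      (ftor_comp \<Y> (radj (em_adjB \<X> \<Y> T)) (ladj (em_adjB \<X> \<Y> T))) (eta (em_adjB \<X> \<Y> T))"
    unfolding UB_GB using T.B.unit.is_nat_trans_axioms by (simp add: em_adjB_def)
  ultimately show ?thesis
    unfolding is_adjunction_def is_adjunction_axioms_def
  proof (intro conjI allI impI, goal_cases)
    case (5 y)
    then show ?case
      by (simp add: em_adjB_def is_em_obj_GB T.B.unit_right T.ract_unit)
  next
    case (6 E)
    then show ?case
      using eps_Arr[of E] em_obj_unit[of E] by (simp add: em_adjB_def)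
  qed (simp_all add: is_functor_GB is_functor_UB)
qed

lemma is_dadj_Gamma_obj: "is_dadj \<X> \<Y> (Gamma_obj \<X> \<Y> T)"
  by (simp add: is_dadj_def Gamma_obj_def is_adjunction_em_adjA is_adjunction_em_adjB)

end


section \<open>The functor from Morita contexts to double adjunctions\<close>

lemma em_pull_obj_simps [simp]:
  "emX (em_pull_obj \<X> \<Y> p E) = emX E"
  "actX (em_pull_obj \<X> \<Y> p E) = actX E \<cdot>\<^bsub>\<X>\<^esub> phi1 p (emX E)"
  "emY (em_pull_obj \<X> \<Y> p E) = emY E"
  "actY (em_pull_obj \<X> \<Y> p E) = actY E \<cdot>\<^bsub>\<Y>\<^esub> phi2 p (emY E)"
  "emv (em_pull_obj \<X> \<Y> p E) = emv E \<cdot>\<^bsub>\<X>\<^esub> phi3 p (emY E)"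
  "emw (em_pull_obj \<X> \<Y> p E) = emw E \<cdot>\<^bsub>\<Y>\<^esub> phi4 p (emX E)"
  by (simp_all add: em_pull_obj_def)

lemma em_pull_simps [simp]:
  "is_em_obj \<X> \<Y> (Tgt p) E \<Longrightarrow> Fo (em_pull \<X> \<Y> p) E = em_pull_obj \<X> \<Y> (Map p) E"
  "h \<in> Arr (EM \<X> \<Y> (Tgt p)) \<Longrightarrow> Fa (em_pull \<X> \<Y> p) h =
    \<lparr>Src = em_pull_obj \<X> \<Y> (Map p) (Src h), Tgt = em_pull_obj \<X> \<Y> (Map p) (Tgt h), Map = Map h\<rparr>"
  by (simp_all add: em_pull_def)

context is_morita_mor
begin

text \<open>
  Each law for the restricted object is the pasting of the equation of the arrow that involves the same
  structure map of the context with the law of the given object.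
\<close>

lemma is_em_obj_pull:
  assumes E: "is_em_obj \<X> \<Y> T' E"
  shows "is_em_obj \<X> \<Y> T (em_pull_obj \<X> \<Y> p E)"
proof -
  note laws = S'.em_obj_laws[OF E] and xy = S'.em_obj_simps(1,2)[OF E]
  show ?thesis
    unfolding is_em_obj_def is_algebra_def
  proof (intro conjI, goal_cases)
    case 3
    show ?case using E p1.square_paste[OF squares(1)[OF xy(1)] laws(1)] by simp
  next
    case 4
    show ?case using E S'.em_obj_unit(1)[OF E] by (simp add: p1.mor_unit)
  next
    case 7
    show ?case using E p2.square_paste[OF squares(2)[OF xy(2)] laws(2)] by simp
  next
    case 8
    show ?case using E S'.em_obj_unit(2)[OF E] by (simp add: p2.mor_unit)
  next
    case 11
    show ?case using E p1.square_paste[OF squares(4)[OF xy(2)] laws(3)] by simp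
  next
    case 12
    show ?case using E p2.square_paste[OF squares(6)[OF xy(1)] laws(4)] by simp
  next
    case 13
    show ?case using E p3.square_paste[OF squares(7)[OF xy(1)] laws(5)] by simp
  next
    case 14
    show ?case using E p4.square_paste[OF squares(8)[OF xy(2)] laws(6)] by simp
  next
    case 15
    show ?case using E p4.square_paste[OF squares(5)[OF xy(1)] laws(7)] by simp
  next
    case 16
    show ?case using E p3.square_paste[OF squares(3)[OF xy(2)] laws(8)] by simp
  qed (use E in \<open>simp_all add: mem_hom\<close>)
qed

end

text \<open>
  A square for \<open>r\<close>, \<open>r'\<close> stays a square after both are precomposed with the components of a natural
  transformation; so a morphism of Eilenberg-Moore objects is still one between the restricted objects.
\<close>

lemma (in is_nat_trans) natural_paste:
  assumes "g \<cdot>\<^bsub>D\<^esub> r = r' \<cdot>\<^bsub>D\<^esub> Fa G f" "f \<in> Arr C" "r \<in> Arr D" "Dom D r = Fo G (Dom C f)"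
    "g \<in> Arr D" "Dom D g = Cod D r" "r' \<in> Arr D" "Dom D r' = Fo G (Cod C f)"
  shows "g \<cdot>\<^bsub>D\<^esub> r \<cdot>\<^bsub>D\<^esub> t (Dom C f) = r' \<cdot>\<^bsub>D\<^esub> t (Cod C f) \<cdot>\<^bsub>D\<^esub> Fa F f"
  using arg_cong[OF assms(1), of "\<lambda>k. k \<cdot>\<^bsub>D\<^esub> t (Dom C f)"] assms(2-) natural[of f] by simp

lemma is_functor_em_pull:
  assumes "is_morita_mor \<X> \<Y> (Src p) (Tgt p) (Map p)"
  shows "is_functor (EM \<X> \<Y> (Tgt p)) (EM \<X> \<Y> (Src p)) (em_pull \<X> \<Y> p)"
proof -
  interpret is_morita_mor \<X> \<Y> "Src p" "Tgt p" "Map p" by fact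
  interpret E': category "EM \<X> \<Y> (Tgt p)" by (rule S'.category_EM)
  show ?thesis
  proof (rule is_functorI, goal_cases)
    case (6 h)
    note laws = S'.em_arr_laws[OF 6]
    have "Fa (em_pull \<X> \<Y> p) h \<in> Arr (EM \<X> \<Y> (Src p))"
      using 6 p1.natural_paste[OF laws(1)] p2.natural_paste[OF laws(2)]
        p3.natural_paste[OF laws(3)] p4.natural_paste[OF laws(4)]
      by (intro S.em_arrI) (simp_all add: is_em_obj_pull)
    with 6 show ?case by simp
  next
    case (7 E)
    with E'.Ide_simps(1)[OF 7] show ?case by simp
  next
    case (8 f g)
    with E'.Comp_simps(1)[OF 8] show ?case by simp
  qed (simp_all add: S.category_EM S'.category_EM is_em_obj_pull, simp_all add: em_pull_def)
qed

lemma is_dadj_mor_em_pull: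
  assumes "is_morita_mor \<X> \<Y> (Src p) (Tgt p) (Map p)"
  shows "is_dadj_mor \<X> \<Y> (Gamma_obj \<X> \<Y> (Src p)) (Gamma_obj \<X> \<Y> (Tgt p)) (em_pull \<X> \<Y> p)"
proof -
  interpret is_morita_mor \<X> \<Y> "Src p" "Tgt p" "Map p" by fact
  note P = is_functor_em_pull[OF assms]
  interpret P: is_functor "EM \<X> \<Y> (Tgt p)" "EM \<X> \<Y> (Src p)" "em_pull \<X> \<Y> p" by (rule P)
  have A: "ftor_comp (EM \<X> \<Y> (Tgt p)) (radj (em_adjA \<X> \<Y> (Src p))) (em_pull \<X> \<Y> p) = radj (em_adjA \<X> \<Y> (Tgt p))"
  proof (rule ftor_eqI[OF is_functor_ftor_comp[OF P S.is_functor_UA] S'.is_functor_UA], goal_cases)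
    case (1 E)
    with P.Fo_Obj[OF 1] show ?case by (simp add: em_adjA_def)
  next
    case (2 h)
    with P.Fa_simps(1)[OF 2] show ?case by (simp add: em_adjA_def)
  qed
  have B: "ftor_comp (EM \<X> \<Y> (Tgt p)) (radj (em_adjB \<X> \<Y> (Src p))) (em_pull \<X> \<Y> p) = radj (em_adjB \<X> \<Y> (Tgt p))"
  proof (rule ftor_eqI[OF is_functor_ftor_comp[OF P S.is_functor_UB] S'.is_functor_UB], goal_cases)
    case (1 E)
    with P.Fo_Obj[OF 1] show ?case by (simp add: em_adjB_def)
  next
    case (2 h)
    with P.Fa_simps(1)[OF 2] show ?case by (simp add: em_adjB_def)
  qed
  from A B P show ?thesis
    using S.is_dadj_Gamma_obj S'.is_dadj_Gamma_obj
    by (simp add: is_dadj_mor_def is_dadj_mor_axioms_def Gamma_obj_def)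
qed

lemma (in is_morita) em_pull_Ide: "em_pull \<X> \<Y> (Ide (Mor \<X> \<Y>) T) = ftor_id \<E>"
proof -
  have P: "is_functor \<E> \<E> (em_pull \<X> \<Y> (Ide (Mor \<X> \<Y>) T))"
    using is_functor_em_pull[of \<X> \<Y> "Ide (Mor \<X> \<Y>) T"] is_morita_mor_Ide[OF is_morita_axioms] by simp
  have obj: "em_pull_obj \<X> \<Y> (Map (Ide (Mor \<X> \<Y>) T)) E = E" if "is_em_obj \<X> \<Y> T E" for E
    using that by (simp add: em_pull_obj_def Mor_def)
  show ?thesis
    by (rule ftor_eqI[OF P is_functor_ftor_id[OF category_EM]]) (simp_all add: obj)
qed

lemma em_pull_Comp:
  assumes "is_morita_mor \<X> \<Y> (Src p) (Tgt p) (Map p)" "is_morita_mor \<X> \<Y> (Src q) (Tgt q) (Map q)"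
    and "Src q = Tgt p"
  shows "em_pull \<X> \<Y> (q \<cdot>\<^bsub>Mor \<X> \<Y>\<^esub> p) = ftor_comp (EM \<X> \<Y> (Tgt q)) (em_pull \<X> \<Y> p) (em_pull \<X> \<Y> q)"
proof -
  interpret p: is_morita_mor \<X> \<Y> "Src p" "Tgt p" "Map p" by fact
  interpret q: is_morita_mor \<X> \<Y> "Tgt p" "Tgt q" "Map q" using assms(2,3) by simp
  have P: "is_functor (EM \<X> \<Y> (Tgt p)) (EM \<X> \<Y> (Src p)) (em_pull \<X> \<Y> p)"
    by (rule is_functor_em_pull) fact
  have Q: "is_functor (EM \<X> \<Y> (Tgt q)) (EM \<X> \<Y> (Tgt p)) (em_pull \<X> \<Y> q)"
    using is_functor_em_pull[OF assms(2)] assms(3) by simp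
  interpret Q: is_functor "EM \<X> \<Y> (Tgt q)" "EM \<X> \<Y> (Tgt p)" "em_pull \<X> \<Y> q" by (rule Q)
  have QP: "is_functor (EM \<X> \<Y> (Tgt q)) (EM \<X> \<Y> (Src p)) (em_pull \<X> \<Y> (q \<cdot>\<^bsub>Mor \<X> \<Y>\<^esub> p))"
    using is_functor_em_pull[of \<X> \<Y> "q \<cdot>\<^bsub>Mor \<X> \<Y>\<^esub> p"] is_morita_mor_Comp[OF assms] by simp
  have obj: "em_pull_obj \<X> \<Y> (Map (q \<cdot>\<^bsub>Mor \<X> \<Y>\<^esub> p)) E = em_pull_obj \<X> \<Y> (Map p) (em_pull_obj \<X> \<Y> (Map q) E)"
    if "is_em_obj \<X> \<Y> (Tgt q) E" for E
    using that by (simp add: em_pull_obj_def Mor_def)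
  show ?thesis
  proof (rule ftor_eqI[OF QP is_functor_ftor_comp[OF Q P]], goal_cases)
    case (1 E)
    with Q.Fo_Obj[OF 1] show ?case by (simp add: obj)
  next
    case (2 h)
    with Q.Fa_simps(1)[OF 2] show ?case by (simp add: obj)
  qed
qed

lemma is_functor_Gamma: "is_functor (Mor \<X> \<Y>) (Adj \<X> \<Y>) (Gamma \<X> \<Y>)"
proof (rule is_functorI, goal_cases)
  case (7 T)
  then show ?case
    using is_morita_mor_Ide[of \<X> \<Y> T] is_morita.em_pull_Ide[of \<X> \<Y> T]
    by (simp add: Gamma_def) (simp add: Gamma_obj_def)
next
  case (8 p q)
  then show ?case
    using is_morita_mor_Comp[of \<X> \<Y> p q] em_pull_Comp[of \<X> \<Y> p q]
    by (simp add: Gamma_def) (simp add: Gamma_obj_def)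
qed (auto simp: category_Mor category_Adj Gamma_def is_morita.is_dadj_Gamma_obj is_dadj_mor_em_pull
    dest: is_morita_mor.axioms)


section \<open>The composite is the identity\<close>

context is_morita
begin

lemma UA_GB: "ftor_comp \<Y> (radj (em_adjA \<X> \<Y> T)) (ladj (em_adjB \<X> \<Y> T)) = fT T"
proof -
  interpret G: is_functor \<Y> \<E> "ladj (em_adjB \<X> \<Y> T)" by (rule is_functor_GB)
  show ?thesis
  proof (rule ftor_eqI[OF is_functor_ftor_comp[OF is_functor_GB is_functor_UA] T.T.is_functor_axioms], goal_cases)
    case (2 f)
    with G.Fa_simps(1)[OF 2] show ?case by (simp add: em_adjA_def em_adjB_def)
  qed (simp add: em_adjA_def em_adjB_def is_em_obj_GB)
qed

lemma UB_GA: "ftor_comp \<X> (radj (em_adjB \<X> \<Y> T)) (ladj (em_adjA \<X> \<Y> T)) = fTh T"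
proof -
  interpret G: is_functor \<X> \<E> "ladj (em_adjA \<X> \<Y> T)" by (rule is_functor_GA)
  show ?thesis
  proof (rule ftor_eqI[OF is_functor_ftor_comp[OF is_functor_GA is_functor_UB] Th.T.is_functor_axioms], goal_cases)
    case (2 f)
    with G.Fa_simps(1)[OF 2] show ?case by (simp add: em_adjA_def em_adjB_def)
  qed (simp add: em_adjA_def em_adjB_def is_em_obj_GA)
qed

lemma radj_eps_simps [simp]:
  assumes "is_em_obj \<X> \<Y> T E"
  shows "Fa (radj (em_adjA \<X> \<Y> T)) (eps (em_adjA \<X> \<Y> T) E) = actX E"
    "Fa (radj (em_adjB \<X> \<Y> T)) (eps (em_adjA \<X> \<Y> T) E) = emw E"
    "Fa (radj (em_adjA \<X> \<Y> T)) (eps (em_adjB \<X> \<Y> T) E) = emv E"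
    "Fa (radj (em_adjB \<X> \<Y> T)) (eps (em_adjB \<X> \<Y> T) E) = actY E"
proof -
  interpret A: is_adjunction \<X> \<E> "em_adjA \<X> \<Y> T" by (rule is_adjunction_em_adjA)
  interpret B: is_adjunction \<Y> \<E> "em_adjB \<X> \<Y> T" by (rule is_adjunction_em_adjB)
  show "Fa (radj (em_adjA \<X> \<Y> T)) (eps (em_adjA \<X> \<Y> T) E) = actX E"
    "Fa (radj (em_adjB \<X> \<Y> T)) (eps (em_adjA \<X> \<Y> T) E) = emw E"
    "Fa (radj (em_adjA \<X> \<Y> T)) (eps (em_adjB \<X> \<Y> T) E) = emv E"
    "Fa (radj (em_adjB \<X> \<Y> T)) (eps (em_adjB \<X> \<Y> T) E) = actY E"
    using assms A.eps.component_simps(1)[of E] B.eps.component_simps(1)[of E] by (simp_all add: em_adjA_def em_adjB_def)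
qed

lemma whisker_counit_eqI:
  assumes "t \<in> extensional (Obj \<W>)" "\<And>w. w \<in> Obj \<W> \<Longrightarrow> Fa R (eps H (Fo L w)) = t w"
  shows "whisker_counit \<W> R H L = t"
  by (rule extensionalityI[OF _ assms(1)]) (simp_all add: whisker_counit_def assms(2))

lemma Upsilon_Gamma_obj: "Upsilon_obj \<X> \<Y> (Gamma_obj \<X> \<Y> T) = T"
proof -
  have [simp]: "Fo (ladj (em_adjA \<X> \<Y> T)) x = GA_obj T x" if "x \<in> Obj \<X>" for x
    using that by (simp add: em_adjA_def)
  have [simp]: "Fo (ladj (em_adjB \<X> \<Y> T)) y = GB_obj T y" if "y \<in> Obj \<Y>" for y
    using that by (simp add: em_adjB_def)
  \<comment> \<open>The three letters of a name are the indices \<open>i, k, j\<close> of \<open>U\<^sub>i \<epsilon>\<^sub>k G\<^sub>j\<close>.\<close>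
  have AAA: "whisker_counit \<X> (radj (em_adjA \<X> \<Y> T)) (em_adjA \<X> \<Y> T) (ladj (em_adjA \<X> \<Y> T)) = mul (mnA T)"
    by (rule whisker_counit_eqI[OF T.A.mul.comp_ext]) (simp add: is_em_obj_GA)
  have BBB: "whisker_counit \<Y> (radj (em_adjB \<X> \<Y> T)) (em_adjB \<X> \<Y> T) (ladj (em_adjB \<X> \<Y> T)) = mul (mnB T)"
    by (rule whisker_counit_eqI[OF T.B.mul.comp_ext]) (simp add: is_em_obj_GB)
  have AAB: "whisker_counit \<Y> (radj (em_adjA \<X> \<Y> T)) (em_adjA \<X> \<Y> T) (ladj (em_adjB \<X> \<Y> T)) = lam T"
    by (rule whisker_counit_eqI[OF T.lact.comp_ext]) (simp add: is_em_obj_GB)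
  have ABB: "whisker_counit \<Y> (radj (em_adjA \<X> \<Y> T)) (em_adjB \<X> \<Y> T) (ladj (em_adjB \<X> \<Y> T)) = rho T"
    by (rule whisker_counit_eqI[OF T.ract.comp_ext]) (simp add: is_em_obj_GB)
  have BBA: "whisker_counit \<X> (radj (em_adjB \<X> \<Y> T)) (em_adjB \<X> \<Y> T) (ladj (em_adjA \<X> \<Y> T)) = lamh T"
    by (rule whisker_counit_eqI[OF Th.lact.comp_ext]) (simp add: is_em_obj_GA)
  have BAA: "whisker_counit \<X> (radj (em_adjB \<X> \<Y> T)) (em_adjA \<X> \<Y> T) (ladj (em_adjA \<X> \<Y> T)) = rhoh T"
    by (rule whisker_counit_eqI[OF Th.ract.comp_ext]) (simp add: is_em_obj_GA)
  have ABA: "whisker_counit \<X> (radj (em_adjA \<X> \<Y> T)) (em_adjB \<X> \<Y> T) (ladj (em_adjA \<X> \<Y> T)) = ev T"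
    by (rule whisker_counit_eqI[OF ev.comp_ext]) (simp add: is_em_obj_GA)
  have BAB: "whisker_counit \<Y> (radj (em_adjB \<X> \<Y> T)) (em_adjA \<X> \<Y> T) (ladj (em_adjB \<X> \<Y> T)) = evh T"
    by (rule whisker_counit_eqI[OF evh.comp_ext]) (simp add: is_em_obj_GB)
  have A: "adj_monad \<X> (em_adjA \<X> \<Y> T) = mnA T"
    by (rule monad.equality) (simp_all add: UA_GA AAA, simp add: em_adjA_def)
  have B: "adj_monad \<Y> (em_adjB \<X> \<Y> T) = mnB T"
    by (rule monad.equality) (simp_all add: UB_GB BBB, simp add: em_adjB_def)
  have C: "adj_bialg \<Y> (em_adjA \<X> \<Y> T) (em_adjB \<X> \<Y> T) = bim T"
    by (rule bialg.equality) (simp_all add: UA_GB AAB ABB)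
  have D: "adj_bialg \<X> (em_adjB \<X> \<Y> T) (em_adjA \<X> \<Y> T) = bimh T"
    by (rule bialg.equality) (simp_all add: UB_GA BBA BAA)
  show ?thesis
    by (simp add: Upsilon_obj_eq Gamma_obj_def A B C D ABA BAB)
qed

end

text \<open>
  If \<open>m\<close> retracts \<open>G u\<close>, then a natural transformation is determined at \<open>x\<close> by its value at \<open>y\<close>.
  With \<open>u\<close> a unit component and \<open>m\<close> a multiplication or a right action this recovers an arrow of Morita
  contexts from the mates of its restriction functor.
\<close>

lemma (in is_nat_trans) natural_retract:
  assumes "m \<cdot>\<^bsub>D\<^esub> Fa G u = Ide D (Fo G x)" "u \<in> Arr C" "Dom C u = x" "Cod C u = y"
    "m \<in> Arr D" "Dom D m = Fo G y"
  shows "m \<cdot>\<^bsub>D\<^esub> t y \<cdot>\<^bsub>D\<^esub> Fa F u = t x"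
proof -
  have [simp]: "x \<in> Obj C" "y \<in> Obj C" using assms(2-4) by auto
  have "m \<cdot>\<^bsub>D\<^esub> t y \<cdot>\<^bsub>D\<^esub> Fa F u = (m \<cdot>\<^bsub>D\<^esub> Fa G u) \<cdot>\<^bsub>D\<^esub> t x"
    using assms(2-) natural[of u] by simp
  then show ?thesis by (simp add: assms(1))
qed

lemma Upsilon_Gamma_map:
  assumes "is_morita_mor \<X> \<Y> (Src p) (Tgt p) (Map p)"
  shows "Upsilon_map \<X> \<Y> \<lparr>Src = Gamma_obj \<X> \<Y> (Src p), Tgt = Gamma_obj \<X> \<Y> (Tgt p), Map = em_pull \<X> \<Y> p\<rparr> = Map p"
    (is "Upsilon_map \<X> \<Y> ?F = _")
proof -
  interpret is_morita_mor \<X> \<Y> "Src p" "Tgt p" "Map p" by fact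
  let ?E = "EM \<X> \<Y> (Src p)" and ?E' = "EM \<X> \<Y> (Tgt p)" and ?A = "em_adjA \<X> \<Y> (Src p)"
    and ?A' = "em_adjA \<X> \<Y> (Tgt p)" and ?B = "em_adjB \<X> \<Y> (Src p)" and ?B' = "em_adjB \<X> \<Y> (Tgt p)"
  note mors = is_dadj_mor_adjunction_mors[OF is_dadj_mor_em_pull[OF assms]]
  interpret a: adjunction_mor \<X> ?E ?E' ?A ?A' "em_pull \<X> \<Y> p"
    using mors(1) by (simp add: Gamma_obj_def)
  interpret b: adjunction_mor \<Y> ?E ?E' ?B ?B' "em_pull \<X> \<Y> p"
    using mors(2) by (simp add: Gamma_obj_def)
  have a: "Map (mate ?E ?A ?A' (em_pull \<X> \<Y> p) x) = (phi1 (Map p) x, phi4 (Map p) x)"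
    if "x \<in> Obj \<X>" for x
    using that p1.natural_retract[OF S'.T.A.unit_right[OF that]] p4.natural_retract[OF S'.Th.ract_unit[OF that]]
    by (simp add: mate_def em_adjA_def S'.is_em_obj_GA is_em_obj_pull)
  have b: "Map (mate ?E ?B ?B' (em_pull \<X> \<Y> p) y) = (phi3 (Map p) y, phi2 (Map p) y)"
    if "y \<in> Obj \<Y>" for y
    using that p2.natural_retract[OF S'.T.B.unit_right[OF that]] p3.natural_retract[OF S'.T.ract_unit[OF that]]
    by (simp add: mate_def em_adjB_def S'.is_em_obj_GB is_em_obj_pull)
  have U: "Fa (radj ?A) h = fst (Map h)" "Fa (radj ?B) h = snd (Map h)" if "h \<in> Arr ?E" for h
    using that by (simp_all add: em_adjA_def em_adjB_def)
  have "is_morita_mor \<X> \<Y> (Upsilon_obj \<X> \<Y> (Src ?F)) (Upsilon_obj \<X> \<Y> (Tgt ?F)) (Upsilon_map \<X> \<Y> ?F)"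
    using is_dadj_mor_em_pull[OF assms] by (intro is_morita_mor_Upsilon_map) simp
  then show ?thesis
    by (rule morita_map_eqI[OF _ assms]) (simp_all add: Upsilon_map_def Gamma_obj_def Let_def U a b)
qed

lemma Upsilon_Gamma: "ftor_comp (Mor \<X> \<Y>) (Upsilon \<X> \<Y>) (Gamma \<X> \<Y>) = ftor_id (Mor \<X> \<Y>)"
proof (rule ftor_eqI[OF is_functor_ftor_comp[OF is_functor_Gamma is_functor_Upsilon]
      is_functor_ftor_id[OF category_Mor]], goal_cases)
  case (1 T)
  then show ?case
    by (simp add: Gamma_def Upsilon_def is_morita.is_dadj_Gamma_obj is_morita.Upsilon_Gamma_obj)
next
  case (2 p)
  then interpret is_morita_mor \<X> \<Y> "Src p" "Tgt p" "Map p" by simp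
  show ?case
    by (simp add: Gamma_def Upsilon_def is_dadj_mor_em_pull is_morita_mor_axioms Upsilon_Gamma_map
        S.Upsilon_Gamma_obj S'.Upsilon_Gamma_obj)
qed

theorem lemma3p4p1:
  fixes \<X> :: "('xo, 'xm) cat" and \<Y> :: "('yo, 'ym) cat"
  assumes "category \<X>" and "category \<Y>"
  shows "is_functor (Mor \<X> \<Y>) (Adj \<X> \<Y>) (Gamma \<X> \<Y>) \<and>
    is_functor (Adj \<X> \<Y> :: (('xo, 'xm, 'yo, 'ym, 'zo, 'zm) dadj,
      ('xo, 'xm, 'yo, 'ym, 'zo, 'zm) dadj_arr) cat) (Mor \<X> \<Y>) (Upsilon \<X> \<Y>) \<and>
    ftor_comp (Mor \<X> \<Y>) (Upsilon \<X> \<Y>) (Gamma \<X> \<Y>) = ftor_id (Mor \<X> \<Y>)"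
  by (simp only: is_functor_Gamma is_functor_Upsilon Upsilon_Gamma)

end
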